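(* Let $n\ge 1$. (1) An element $F\in\mathbf{GL}_n(\mathbf{Z})$ represents an isodual algebraic type if and only if $FF^\vee$ has finite order. (2) The set of isodual algebraic types of rank $n$ is finite. (3) The set of isodual geometric types of rank $n$ is finite.
   Context: For a square matrix $F$, $F'$ denotes its transpose and $F^\vee=(F')^{-1}$. An isodual lattice is a pair $(\Lambda,\sigma)$ where $\Lambda$ is a lattice in a Euclidean space $E$ of dimension $n$ (scalar product $\langle\cdot,\cdot\rangle$) and $\sigma$ is an isometry of $E$ with $\sigma(\Lambda)=\Lambda^*$ (the dual lattice). The bilinear form $\alpha(u,v)=\langle u,\sigma(v)\rangle$ is integral on $\Lambda\times\Lambda$; if $F\in\mathbf{GL}_n(\mathbf{Z})$ is the matrix of $\alpha|_{\Lambda\times\Lambda}$ in some basis of $\Lambda$, one says that $F$ represents the algebraic type of $(\Lambda,\sigma)$, which is the class of $F$ under integral equivalence $F\mapsto TFT'$, $T\in\mathbf{GL}_n(\mathbf{Z})$ (equivalently the isometry class of the $\mathbf{Z}$-bilinear module $(\Lambda,\alpha|_{\Lambda\times\Lambda})$); an isodual algebraic type of rank $n$ is such a class. Let $P_n$ be the set of real symmetric positive definite $n\times n$ matrices of determinant $1$, on which $\mathbf{GL}_n(\mathbf{Z})$ acts by $T\cdot A=TAT'$. For such $F$ set $V_F=\{A\in P_n;\ AF^\vee A=F\}$. The geometric type of $(\Lambda,\sigma)$ is the $\mathbf{GL}_n(\mathbf{Z})$-orbit of the subset $V_F$ of $P_n$ (i.e. the class of $V_F$ under $V\mapsto T\cdot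 V$, $T\in\mathbf{GL}_n(\mathbf{Z})$); isodual geometric types of rank $n$ are these classes. *)

theory Defs
  imports "HOL-Analysis.Analysis"
begin

text \<open>The rank is \<open>CARD('n)\<close>, and the Euclidean space of dimension \<open>CARD('n)\<close> is modelled
  by \<open>real ^ 'n\<close> with its standard scalar product.\<close>

definition GLZ :: "(int^'n^'n) set" where
  "GLZ = {F. invertible F}"

definition contragredient :: "int^'n^'n \<Rightarrow> int^'n^'n" where
  "contragredient F = matrix_inv (transpose F)"

text \<open>The operation \<open>^\<close> on vectors is componentwise, so matrix powers are iterated \<open>**\<close>.\<close>

definition has_finite_order :: "int^'n^'n \<Rightarrow> bool" where
  "has_finite_order M \<longleftrightarrow> (\<exists>k>0. (((**) M) ^^ k) (mat 1) = mat 1)"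

definition real_matrix :: "int^'n^'n \<Rightarrow> real^'n^'n" where
  "real_matrix = map_matrix of_int"


subsection \<open>Isodual lattices\<close>

definition lattice_basis :: "('n \<Rightarrow> real^'n) \<Rightarrow> (real^'n) set \<Rightarrow> bool" where
  "lattice_basis b L \<longleftrightarrow> inj b \<and> independent (range b) \<and>
     L = {(\<Sum>i\<in>UNIV. of_int (c i) *\<^sub>R b i) | c :: 'n \<Rightarrow> int. True}"

definition lattice :: "(real^'n) set \<Rightarrow> bool" where
  "lattice L \<longleftrightarrow> (\<exists>b. lattice_basis b L)"

definition dual_lattice :: "(real^'n) set \<Rightarrow> (real^'n) set" where
  "dual_lattice L = {y. \<forall>x\<in>L. x \<bullet> y \<in> \<int>}"

definition isodual_lattice :: "(real^'n) set \<Rightarrow> (real^'n \<Rightarrow> real^'n) \<Rightarrow> bool" where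
  "isodual_lattice L \<sigma> \<longleftrightarrow> lattice L \<and> orthogonal_transformation \<sigma> \<and> \<sigma> ` L = dual_lattice L"


subsection \<open>Algebraic types\<close>

definition represents_type_of ::
  "int^'n^'n \<Rightarrow> (real^'n) set \<Rightarrow> (real^'n \<Rightarrow> real^'n) \<Rightarrow> bool" where
  "represents_type_of F L \<sigma> \<longleftrightarrow> F \<in> GLZ \<and>
     (\<exists>b. lattice_basis b L \<and> (\<forall>i j. of_int (F $ i $ j) = b i \<bullet> \<sigma> (b j)))"

definition represents_isodual_type :: "int^'n^'n \<Rightarrow> bool" where
  "represents_isodual_type F \<longleftrightarrow> (\<exists>L \<sigma>. isodual_lattice L \<sigma> \<and> represents_type_of F L \<sigma>)"

definition integral_class :: "int^'n^'n \<Rightarrow> (int^'n^'n) set" where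
  "integral_class F = {T ** F ** transpose T | T. T \<in> GLZ}"

definition isodual_algebraic_types :: "(int^'n^'n) set set" where
  "isodual_algebraic_types = {integral_class F | F. represents_isodual_type F}"


subsection \<open>Geometric types\<close>

definition P_space :: "(real^'n^'n) set" where
  "P_space = {A. transpose A = A \<and> (\<forall>x. x \<noteq> 0 \<longrightarrow> 0 < x \<bullet> (A *v x)) \<and> det A = 1}"

definition GLZ_act :: "int^'n^'n \<Rightarrow> real^'n^'n \<Rightarrow> real^'n^'n" where
  "GLZ_act T A = real_matrix T ** A ** transpose (real_matrix T)"

definition V_set :: "int^'n^'n \<Rightarrow> (real^'n^'n) set" where
  "V_set F = {A \<in> P_space. A ** real_matrix (contragredient F) ** A = real_matrix F}"

definition subset_orbit :: "(real^'n^'n) set \<Rightarrow> (real^'n^'n) set set" where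
  "subset_orbit V = {GLZ_act T ` V | T. T \<in> GLZ}"

definition isodual_geometric_types :: "(real^'n^'n) set set set" where
  "isodual_geometric_types = {subset_orbit (V_set F) | F. represents_isodual_type F}"

end

theory Submission
  imports Defs
begin

text \<open>If \<open>B\<close> has the vectors of a basis of \<open>\<Lambda>\<close> as rows and \<open>S\<close> is the matrix of \<open>\<sigma>\<close>, then \<open>F = BSB'\<close>;
  conversely an integral unimodular matrix of this form comes from an isodual lattice. Since
  \<open>FF\<^sup>\<or> = BS\<^sup>2B\<inverse>\<close>, its powers are bounded integral matrices, so it has finite order. If conversely
  \<open>M = FF\<^sup>\<or>\<close> has finite order, it preserves a positive definite form, obtained by averaging; square roots
  of positive definite matrices then produce \<open>B\<close> and \<open>S\<close>.

  For finiteness, choose a Hermite-Korkine-Zolotarev reduced basis of \<open>\<Lambda>\<close>, with Gram-Schmidt vectors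
  \<open>g i\<close> and dual basis \<open>c i\<close>. Reduction gives \<open>|c i| \<le> K / |g i|\<close>, while both the entries of \<open>F\<close> and
  the numbers \<open>c i \<bullet> \<sigma> (c j)\<close>, the entries of \<open>F\<^sup>\<or>\<close>, are integers. Together these bound
  \<open>g i \<bullet> \<sigma> (g j)\<close>, hence \<open>F\<close>, in terms of the rank alone. As the orbit of \<open>V_set F\<close> depends only
  on the integral class of \<open>F\<close>, there are also finitely many geometric types.\<close>

subsection \<open>Square roots of positive definite matrices\<close>

text \<open>The fixed point equation says \<open>(1 - Y)\<^sup>2 = 1 - E\<close>; it is solved by contraction, inside the closed
  set of self-adjoint operators commuting with the commutant of \<open>E\<close>.\<close>

lemma half_square_fixpoint:
  fixes E :: "'a::euclidean_space \<Rightarrow>\<^sub>L 'a"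
  assumes q: "norm E \<le> q" "q < 1" and sym: "\<And>x y. E x \<bullet> y = x \<bullet> E y"
  obtains Y :: "'a \<Rightarrow>\<^sub>L 'a" where "norm Y \<le> q" "\<And>x y. Y x \<bullet> y = x \<bullet> Y y"
    "\<And>G. G o\<^sub>L E = E o\<^sub>L G \<Longrightarrow> G o\<^sub>L Y = Y o\<^sub>L G" "Y = (1/2) *\<^sub>R (E + (Y o\<^sub>L Y))"
proof -
  define s where "s = {Y :: 'a \<Rightarrow>\<^sub>L 'a. norm Y \<le> q \<and>
    (\<forall>x y. blinfun_apply Y x \<bullet> y = x \<bullet> blinfun_apply Y y) \<and>
    (\<forall>G. G o\<^sub>L E = E o\<^sub>L G \<longrightarrow> G o\<^sub>L Y = Y o\<^sub>L G)}"
  define f where "f Y = (1/2) *\<^sub>R (E + (Y o\<^sub>L Y))" for Y :: "'a \<Rightarrow>\<^sub>L 'a"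
  have q0: "0 \<le> q" using q(1) norm_ge_zero order_trans by blast
  \<comment> \<open>Every condition defining \<open>s\<close> is closed, so \<open>s\<close> is
    complete and the fixed point inherits self-adjointness and the commutation property.\<close>
  have "closed s"
    unfolding s_def
    by (intro closed_Collect_conj closed_Collect_all closed_Collect_le closed_Collect_eq
         closed_Collect_imp open_Collect_const continuous_intros)
  then have 1: "complete s" by (simp add: complete_eq_closed)
  have 2: "s \<noteq> {}" using q0 by (auto simp: s_def intro!: exI[of _ 0])
  have "f Y \<in> s" if "Y \<in> s" for Y
  proof -
    have nY: "norm Y \<le> q" and sY: "\<And>x y. Y x \<bullet> y = x \<bullet> Y y" 
      and cY: "\<And>G. G o\<^sub>L E = E o\<^sub>L G \<Longrightarrow> G o\<^sub>L Y = Y o\<^sub>L G"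
      using that by (auto simp: s_def)
    have "norm (Y o\<^sub>L Y) \<le> norm Y * norm Y" by (rule norm_blinfun_compose)
    also have "\<dots> \<le> q * 1" using nY q q0 by (intro mult_mono) auto
    finally have "norm (f Y) \<le> q"
      unfolding f_def using norm_triangle_ineq[of E "Y o\<^sub>L Y"] q by simp
    moreover have "f Y x \<bullet> y = x \<bullet> f Y y" for x y
      by (simp add: f_def blinfun.add_left blinfun.scaleR_left inner_add sym sY)
    moreover have "G o\<^sub>L f Y = f Y o\<^sub>L G" if "G o\<^sub>L E = E o\<^sub>L G" for G
    proof -
      have e: "G (E x) = E (G x)" "G (Y x) = Y (G x)" for x
        using that cY[OF that] by (metis blinfun_apply_blinfun_compose)+
      show ?thesis
        by (rule blinfun_eqI)
          (simp add: f_def blinfun.add_left blinfun.scaleR_left blinfun.add_right blinfun.scaleR_right e)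
    qed
    ultimately show ?thesis by (simp add: s_def)
  qed
  then have 3: "f ` s \<subseteq> s" by auto
  have 4: "dist (f Y) (f Z) \<le> q * dist Y Z" if "Y \<in> s" "Z \<in> s" for Y Z
  proof -
    \<comment> \<open>Y Y - Z Z = Y (Y - Z) + (Y - Z) Z holds without commutativity. Both terms have
      norm at most q |Y - Z|, and the factor 1/2 leaves the contraction constant q.\<close>
    have e: "f Y - f Z = (1/2) *\<^sub>R ((Y o\<^sub>L (Y - Z)) + ((Y - Z) o\<^sub>L Z))"
      by (rule blinfun_eqI)
        (simp add: f_def blinfun.bilinear_simps scaleR_diff_right[symmetric])
    have "norm (Y o\<^sub>L (Y - Z)) \<le> q * norm (Y - Z)" "norm ((Y - Z) o\<^sub>L Z) \<le> norm (Y - Z) * q"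
      using that by (auto simp: s_def intro!: order_trans[OF norm_blinfun_compose] mult_mono q0)
    then show ?thesis
      unfolding dist_norm e using norm_triangle_ineq[of "Y o\<^sub>L (Y - Z)" "(Y - Z) o\<^sub>L Z"]
      by (simp add: mult.commute)
  qed
  have "\<exists>!Y\<in>s. f Y = Y" by (rule Banach_fix[OF 1 2 q0 q(2) 3 4])
  then obtain Y where "Y \<in> s" "f Y = Y" by blast
  show ?thesis
  proof (rule that[of Y])
    show "norm Y \<le> q" "\<And>x y. Y x \<bullet> y = x \<bullet> Y y" "\<And>G. G o\<^sub>L E = E o\<^sub>L G \<Longrightarrow> G o\<^sub>L Y = Y o\<^sub>L G"
      using \<open>Y \<in> s\<close> by (simp_all add: s_def)
    show "Y = (1/2) *\<^sub>R (E + (Y o\<^sub>L Y))"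
      by (rule \<open>f Y = Y\<close>[unfolded f_def, symmetric])
  qed
qed

text \<open>This is membership in \<open>P_space\<close> without the determinant condition, because
  forms obtained by averaging are not normalised.\<close>

definition posdef :: "real^'n^'n \<Rightarrow> bool" where
  "posdef A \<longleftrightarrow> transpose A = A \<and> (\<forall>x. x \<noteq> 0 \<longrightarrow> 0 < x \<bullet> (A *v x))"

text \<open>The quadratic form attains a positive minimum on the compact unit sphere; homogeneity
  carries the bound to all vectors.\<close>

lemma posdef_coercive:
  assumes "posdef A" obtains m where "0 < m" "\<And>x. m * (norm x)\<^sup>2 \<le> x \<bullet> (A *v x)"
proof -
  let ?S = "sphere (0::real^'a) 1"
  have "compact ?S" "?S \<noteq> {}" by auto
  moreover have "continuous_on ?S (\<lambda>x. x \<bullet> (A *v x))"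
    by (intro continuous_intros matrix_vector_mult_linear_continuous_on)
  ultimately obtain u where u: "u \<in> ?S" "\<And>x. x \<in> ?S \<Longrightarrow> u \<bullet> (A *v u) \<le> x \<bullet> (A *v x)"
    using continuous_attains_inf by (metis (no_types, lifting))
  show ?thesis
  proof (rule that[of "u \<bullet> (A *v u)"])
    have "u \<noteq> 0" using u(1) by auto
    then show "0 < u \<bullet> (A *v u)" using assms by (simp add: posdef_def)
    fix x :: "real^'a"
    show "u \<bullet> (A *v u) * (norm x)\<^sup>2 \<le> x \<bullet> (A *v x)"
    proof (cases "x = 0")
      case False
      define y where "y = (1 / norm x) *\<^sub>R x"
      have xy: "x = norm x *\<^sub>R y" and "y \<in> ?S" using False by (auto simp: y_def)
      have "x \<bullet> (A *v x) = (norm x)\<^sup>2 * (y \<bullet> (A *v y))"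
        by (subst (1 2) xy) (simp add: matrix_vector_mult_scaleR power2_eq_square)
      also have "\<dots> \<ge> (norm x)\<^sup>2 * (u \<bullet> (A *v u))"
        by (rule mult_left_mono[OF u(2)[OF \<open>y \<in> ?S\<close>]]) simp
      finally show ?thesis by (simp only: mult.commute)
    qed simp
  qed
qed

lemma inner_matrix_symmetric:
  fixes A :: "real^'n^'n"
  assumes "transpose A = A" shows "(A *v x) \<bullet> y = x \<bullet> (A *v y)"
  by (metis assms dot_lmul_matrix vector_transpose_matrix)

text \<open>For suitable t > 0 the matrix E = 1 - tH has norm below 1, and its fixed point Y
  satisfies (1 - Y)(1 - Y) = tH, so P = (1 - Y) / sqrt t. Positivity follows from |Y| < 1. The
  commutation clause passes from H to E, then to Y and P; it later transfers commutation with a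
  normal matrix to a root.\<close>

lemma posdef_sqrt:
  fixes H :: "real^'n^'n"
  assumes "posdef H"
  obtains P where "posdef P" "P ** P = H" "\<And>G. G ** H = H ** G \<Longrightarrow> G ** P = P ** G"
proof -
  have symH: "transpose H = H" using assms by (simp add: posdef_def)
  obtain m where m: "0 < m" "\<And>x. m * (norm x)\<^sup>2 \<le> x \<bullet> (H *v x)"
    using posdef_coercive[OF assms] by blast
  obtain K where K: "0 < K" "\<And>x. norm (H *v x) \<le> norm x * K"
    using bounded_linear.pos_bounded[OF matrix_vector_mul_bounded_linear[of H]] by blast
  have mK: "m \<le> K"
  proof -
    fix i :: 'n
    define e :: "real^'n" where "e = axis i 1"
    have ne: "norm e = 1" by (simp add: e_def)
    have "m \<le> e \<bullet> (H *v e)" using m(2)[of e] ne by simp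
    also have "\<dots> \<le> norm e * norm (H *v e)" by (rule norm_cauchy_schwarz)
    also have "\<dots> \<le> K" using K(2)[of e] ne by simp
    finally show ?thesis .
  qed
  \<comment> \<open>This t minimises the bound 1 - 2tm + t^2 K^2 for the squared norm of E. The
    minimum is 1 - tm, the square of \<open>q\<close>, and \<open>mK\<close> keeps it
    nonnegative.\<close>
  define t where "t = m / K\<^sup>2"
  define q where "q = sqrt (1 - t * m)"
  have t0: "t > 0" using m K by (simp add: t_def)
  have tm: "0 < t * m" "t * m \<le> 1"
    using t0 m mK K by (auto simp: t_def divide_simps power2_eq_square intro!: mult_mono)
  then have q: "q < 1" "0 \<le> q" "q\<^sup>2 = 1 - t * m" by (auto simp: q_def)
  have tK: "t\<^sup>2 * K\<^sup>2 = t * m" using K by (simp add: t_def power2_eq_square)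
  define E where "E = Blinfun (\<lambda>x. x - t *\<^sub>R (H *v x))"
  have E: "E x = x - t *\<^sub>R (H *v x)" for x
    unfolding E_def
    by (subst bounded_linear_Blinfun_apply)
       (auto intro!: bounded_linear_sub bounded_linear_ident bounded_linear_scaleR_right bounded_linear_compose[OF bounded_linear_scaleR_right])
  have "norm E \<le> q"
  proof (rule norm_blinfun_bound[OF q(2)])
    fix x :: "real^'n"
    have "(norm (E x))\<^sup>2 = (norm x)\<^sup>2 - 2 * t * (x \<bullet> (H *v x)) + t\<^sup>2 * (norm (H *v x))\<^sup>2"
      unfolding E power2_norm_eq_inner
      by (simp add: inner_diff inner_commute algebra_simps power2_eq_square)
    also have "\<dots> \<le> (norm x)\<^sup>2 - 2 * t * (m * (norm x)\<^sup>2) + t\<^sup>2 * (norm x * K)\<^sup>2"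
      using m(2)[of x] K(2)[of x] t0 by (intro add_mono diff_mono mult_left_mono power_mono) auto
    also have "\<dots> = (q * norm x)\<^sup>2"
      using tK by (simp add: power_mult_distrib q(3) algebra_simps)
    finally show "norm (E x) \<le> q * norm x"
      using q(2) by (simp add: power2_le_iff_abs_le)
  qed
  moreover have "E x \<bullet> y = x \<bullet> E y" for x y
    by (simp add: E inner_diff inner_matrix_symmetric[OF symH])
  ultimately obtain Y :: "(real^'n) \<Rightarrow>\<^sub>L (real^'n)" where Y: "norm Y \<le> q" "\<And>x y. Y x \<bullet> y = x \<bullet> Y y"
    "\<And>G. G o\<^sub>L E = E o\<^sub>L G \<Longrightarrow> G o\<^sub>L Y = Y o\<^sub>L G" "Y = (1/2) *\<^sub>R (E + (Y o\<^sub>L Y))"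
    using half_square_fixpoint q(1) by blast
  define r where "r = 1 / sqrt t"
  have r: "r > 0" "r * r * t = 1" using t0 by (auto simp: r_def)
  define P where "P = matrix (\<lambda>x. r *\<^sub>R (x - Y x))"
  have lin: "linear (\<lambda>x. r *\<^sub>R (x - Y x))"
    by (intro linearI) (auto simp: blinfun.bilinear_simps algebra_simps)
  have P: "P *v x = r *\<^sub>R (x - Y x)" for x
    unfolding P_def using lin by (simp add: matrix_works)
  have PP: "P ** P = H"
  proof -
    have "P *v (P *v x) = H *v x" for x
    proof -
      have "Y x = (1/2) *\<^sub>R (E x + Y (Y x))"
        by (subst Y(4)) (simp add: blinfun.bilinear_simps)
      then have "2 *\<^sub>R Y x = 2 *\<^sub>R ((1/2) *\<^sub>R (E x + Y (Y x)))"
        by (rule arg_cong)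
      then have y: "2 *\<^sub>R Y x = x - t *\<^sub>R (H *v x) + Y (Y x)"
        by (simp add: E)
      have "P *v (P *v x) = (r * r) *\<^sub>R (x + Y (Y x) - 2 *\<^sub>R Y x)"
        by (simp add: P blinfun.bilinear_simps algebra_simps scaleR_2)
      also have "\<dots> = (r * r) *\<^sub>R (t *\<^sub>R (H *v x))" by (simp add: y)
      finally show ?thesis using r by simp
    qed
    then show ?thesis by (simp add: matrix_eq matrix_vector_mul_assoc)
  qed
  have pdP: "posdef P"
    unfolding posdef_def
  proof (intro conjI allI impI)
    have "transpose P *v x = P *v x" for x
    proof (rule vector_eq_rdot[THEN iffD1], rule allI)
      fix y
      have "(transpose P *v x) \<bullet> y = x \<bullet> (P *v y)"
        by (metis dot_lmul_matrix transpose_matrix_vector)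
      also have "\<dots> = (P *v x) \<bullet> y" by (simp add: P inner_diff Y(2))
      finally show "(transpose P *v x) \<bullet> y = (P *v x) \<bullet> y" .
    qed
    then show "transpose P = P" unfolding matrix_eq by blast
    fix x :: "real^'n" assume x: "x \<noteq> 0"
    have "x \<bullet> Y x \<le> norm x * (norm Y * norm x)"
      by (rule order_trans[OF norm_cauchy_schwarz]) (simp add: mult_left_mono norm_blinfun)
    also have "\<dots> \<le> norm x * (q * norm x)" using Y(1) q(2) by (intro mult_mono) auto
    also have "\<dots> < norm x * (1 * norm x)" using x q by (intro mult_strict_left_mono mult_strict_right_mono) auto
    finally show "0 < x \<bullet> (P *v x)"
      using r by (simp add: P inner_diff_right dot_square_norm power2_eq_square)
  qed
  have "G ** P = P ** G" if "G ** H = H ** G" for G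
  proof -
    define g where "g = Blinfun ((*v) G)"
    have g: "g x = G *v x" for x
      unfolding g_def by (simp add: bounded_linear_Blinfun_apply)
    have GH: "G *v (H *v x) = H *v (G *v x)" for x using that by (metis matrix_vector_mul_assoc)
    have "g o\<^sub>L E = E o\<^sub>L g"
      by (rule blinfun_eqI) (simp add: g E GH matrix_vector_mult_diff_distrib matrix_vector_mult_scaleR)
    then have "g o\<^sub>L Y = Y o\<^sub>L g" by (rule Y(3))
    then have "G *v (Y x) = Y (G *v x)" for x using g by (metis blinfun_apply_blinfun_compose)
    then have "G *v (P *v x) = P *v (G *v x)" for x
      by (simp add: P matrix_vector_mult_diff_distrib matrix_vector_mult_scaleR)
    then show ?thesis by (simp add: matrix_eq matrix_vector_mul_assoc)
  qed
  then show ?thesis by (rule that[OF pdP PP])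
qed


subsection \<open>Reduced bases of lattices\<close>

text \<open>Viewing a real vector space as a module over the integers makes the theory of spans
  available for lattices: \<open>int_span S\<close> is the additive subgroup generated by
  \<open>S\<close>.\<close>

global_interpretation int_module: module "\<lambda>(k::int) (v::'a::real_vector). of_int k *\<^sub>R v"
  defines int_span = int_module.span
  by unfold_locales (simp_all add: scaleR_add_right scaleR_add_left)

lemma int_span_linear_image:
  assumes "linear f" shows "int_span (f ` S) = f ` int_span S"
proof -
  interpret module_hom "\<lambda>(k::int) v. of_int k *\<^sub>R v" "\<lambda>(k::int) v. of_int k *\<^sub>R v" f
    by unfold_locales (simp_all add: linear_add[OF assms] linear_scale[OF assms])
  show ?thesis by (rule span_image[folded int_span_def])
qed

lemma int_span_subset_span: "int_span S \<subseteq> span S"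
  by (rule int_module.span_minimal)
    (auto simp: span_base span_zero span_add span_scale int_module.subspace_def)

lemma span_int_span: "span (int_span S) = span S"
  by (metis int_module.span_superset int_span_subset_span span_eq span_superset subset_trans)

text \<open>Coordinates with respect to \<open>S\<close> are linear and hence bounded functionals,
  so a short vector has integer coefficients in a bounded range.\<close>

lemma finite_int_span_bounded:
  fixes S :: "'a::euclidean_space set"
  assumes S: "finite S" "independent S"
  shows "finite {x \<in> int_span S. norm x \<le> r}"
proof -
  \<comment> \<open>These are the coordinate functionals, extended from the span of \<open>S\<close>
    to the whole space.\<close>
  have "\<exists>f. linear f \<and> (\<forall>t\<in>S. f t = (if t = s then 1 else 0::real))" for s
    using linear_independent_extend[OF S(2), of "\<lambda>t. if t = s then 1 else 0"] .
  then obtain f where f: "\<And>s. linear (f s)" "\<And>s t. t \<in> S \<Longrightarrow> f s t = (if t = s then 1 else 0::real)"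
    by metis
  have "\<exists>K. \<forall>x. norm (f s x) \<le> norm x * K \<and> 0 < K" for s
    using bounded_linear.pos_bounded[OF linear_conv_bounded_linear[THEN iffD1, OF f(1)]] by blast
  then obtain K where K: "\<And>s x. norm (f s x) \<le> norm x * K s" "\<And>s. 0 < K s" by metis
  let ?B = "PiE S (\<lambda>s. {-\<lceil>r * K s\<rceil>..\<lceil>r * K s\<rceil>})"
  have "finite ?B" using S(1) by (intro finite_PiE) auto
  moreover have "{x \<in> int_span S. norm x \<le> r} \<subseteq> (\<lambda>c. \<Sum>s\<in>S. of_int (c s) *\<^sub>R s) ` ?B"
  proof
    fix x assume "x \<in> {x \<in> int_span S. norm x \<le> r}"
    then have x: "norm x \<le> r" "x \<in> int_span S" by auto
    then obtain c where c: "x = (\<Sum>s\<in>S. of_int (c s) *\<^sub>R s)"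
      using int_module.span_finite[OF S(1)] by (auto simp:)
    have "\<bar>c s\<bar> \<le> \<lceil>r * K s\<rceil>" if "s \<in> S" for s
    proof -
      have "f s x = (\<Sum>t\<in>S. of_int (c t) * f s t)"
        by (simp add: c linear_sum[OF f(1)] linear_scale[OF f(1)])
      also have "\<dots> = (\<Sum>t\<in>S. if t = s then of_int (c t) else 0)"
        by (rule sum.cong) (auto simp: f(2))
      also have "\<dots> = of_int (c s)" using S(1) that by simp
      finally have "\<bar>of_int (c s)\<bar> \<le> norm x * K s" using K(1)[of s x] by simp
      also have "\<dots> \<le> r * K s" using x K(2)[of s] by (intro mult_right_mono) auto
      finally have "real_of_int \<bar>c s\<bar> \<le> r * K s" by simp
      then show ?thesis by linarith
    qed
    then have "restrict c S \<in> ?B" by (fastforce simp: abs_le_iff)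
    moreover have "x = (\<Sum>s\<in>S. of_int (restrict c S s) *\<^sub>R s)" unfolding c by (rule sum.cong) auto
    ultimately show "x \<in> (\<lambda>c. \<Sum>s\<in>S. of_int (c s) *\<^sub>R s) ` ?B" by blast
  qed
  ultimately show ?thesis by (meson finite_imageI finite_subset)
qed

text \<open>Equal integral spans have equal real spans, and k vectors generating a k-dimensional
  space are distinct and independent.\<close>

lemma independent_if_same_int_span:
  fixes S :: "'a::euclidean_space set"
  assumes "independent S" "card S = k" "int_span (b ` {..<k}) = int_span S"
  shows "inj_on b {..<k} \<and> independent (b ` {..<k})"
proof -
  have sp: "span (b ` {..<k}) = span S" using assms(3) span_int_span by metis
  have d: "dim (span S) = k" using assms dim_span_eq_card_independent by auto
  have "k \<le> card (b ` {..<k})" using dim_le_card[of "span S" "b ` {..<k}"] sp d by simp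
  then have c: "card (b ` {..<k}) = k" using card_image_le[of "{..<k}" b] by simp
  then have "inj_on b {..<k}" by (intro eq_card_imp_inj_on) auto
  moreover have "independent (b ` {..<k})"
    using card_le_dim_spanning[of "b ` {..<k}" "span S"] sp d c span_superset[of "b ` {..<k}"] by auto
  ultimately show ?thesis ..
qed

text \<open>\<open>g\<close> is the Gram-Schmidt family of \<open>b\<close> and \<open>N\<close>
  holds its coefficients. The last clause is the consequence of Hermite-Korkine-Zolotarev minimality
  that the estimates use; 4/3 is 1 / (1 - 1/4), with 1/4 the square of the bound on
  \<open>N\<close>. Indices are naturals so that an induction on the rank can shift them.\<close>

definition gs_reduced :: "nat \<Rightarrow> (nat \<Rightarrow> 'a::real_inner) \<Rightarrow> (nat \<Rightarrow> 'a) \<Rightarrow> (nat \<Rightarrow> nat \<Rightarrow> real) \<Rightarrow> bool" where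
  "gs_reduced k b g N \<longleftrightarrow> (\<forall>i<k. g i \<noteq> 0) \<and> (\<forall>i<k. \<forall>j<k. i \<noteq> j \<longrightarrow> g i \<bullet> g j = 0) \<and>
     (\<forall>i<k. b i = g i + (\<Sum>j<i. N i j *\<^sub>R g j)) \<and> (\<forall>i<k. \<forall>j<i. \<bar>N i j\<bar> \<le> 1/2) \<and>
     (\<forall>i. Suc i < k \<longrightarrow> (norm (g i))\<^sup>2 \<le> 4/3 * (norm (g (Suc i)))\<^sup>2)"

text \<open>The first basis vector \<open>v\<close> is shortest among the members of bases of the lattice; the others lift
  a reduced basis of the projection of the lattice along \<open>v\<close>.\<close>

lemma ex_gs_reduced:
  fixes S :: "'a::euclidean_space set"
  assumes "independent S" "card S = k"
  shows "\<exists>b g N. gs_reduced k b g N \<and> int_span (b ` {..<k}) = int_span S \<and> (\<forall>i<k. g i \<in> span S)"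
  using assms
proof (induction k arbitrary: S)
  case 0
  then have "S = {}" using finiteI_independent card_0_eq by blast
  then show ?case by (auto simp: gs_reduced_def)
next
  case (Suc k)
  \<comment> \<open>\<open>C\<close> consists of the vectors that extend to a basis of the lattice.
    The one competitor that \<open>v\<close> must beat later, \<open>b 1\<close>, is itself a member
    of a basis.\<close>
  define C where "C = {v. \<exists>R. card R = k \<and> v \<notin> R \<and> independent (insert v R) \<and> int_span (insert v R) = int_span S}"
  have finS: "finite S" using Suc.prems(1) by (rule finiteI_independent)
  have "S \<noteq> {}" using Suc.prems by auto
  then obtain s where s: "s \<in> S" by blast
  then have "insert s (S - {s}) = S" "card (S - {s}) = k" using Suc.prems finS by auto
  then have sC: "s \<in> C" unfolding C_def using Suc.prems by (auto intro!: exI[of _ "S - {s}"])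
  have CS: "C \<subseteq> int_span S"
    unfolding C_def by (auto intro: int_module.span_base)
  \<comment> \<open>Cutting off at the norm of one member of \<open>C\<close> leaves a finite
    nonempty set, so a shortest member exists.\<close>
  let ?T = "{w \<in> C. norm w \<le> norm s}"
  have "finite ?T"
    using finite_int_span_bounded[OF finS Suc.prems(1), of "norm s"] CS by (elim finite_subset[rotated]) auto
  moreover have "?T \<noteq> {}" using sC by auto
  ultimately obtain v where v: "v \<in> ?T" "\<And>w. w \<in> ?T \<Longrightarrow> norm v \<le> norm w"
    using ex_is_arg_min_if_finite[of ?T norm] unfolding is_arg_min_linorder by blast
  then have vC: "v \<in> C" and vmin: "\<And>w. w \<in> C \<Longrightarrow> norm v \<le> norm w" by force+
  obtain R where R: "card R = k" "v \<notin> R" "independent (insert v R)" "int_span (insert v R) = int_span S"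
    using vC by (auto simp: C_def)
  have indR: "independent R" and vR: "v \<notin> span R" using R(2,3) by (simp_all add: independent_insert)
  have v0: "v \<noteq> 0" using vR span_zero by auto
  then have vv: "v \<bullet> v > 0" by simp
  define p where "p x = x - ((x \<bullet> v) / (v \<bullet> v)) *\<^sub>R v" for x
  have linp: "linear p"
    by (rule linearI) (auto simp: p_def inner_left_distrib add_divide_distrib algebra_simps)
  have pv: "p x \<bullet> v = 0" for x using vv by (simp add: p_def inner_diff_left)
  \<comment> \<open>The kernel of \<open>p\<close> is the line through \<open>v\<close>, which meets
    \<open>span R\<close> only in 0.\<close>
  have injp: "inj_on p (span R)"
  proof (subst linear_inj_on_iff_eq_0[OF linp])
    show "\<forall>x\<in>span R. p x = 0 \<longrightarrow> x = 0"
    proof (intro ballI impI)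
      fix x assume x: "x \<in> span R" "p x = 0"
      then have e: "x = ((x \<bullet> v) / (v \<bullet> v)) *\<^sub>R v" by (simp add: p_def)
      show "x = 0"
      proof (rule ccontr)
        assume "x \<noteq> 0"
        then have "(x \<bullet> v) / (v \<bullet> v) \<noteq> 0" using e by (metis scaleR_zero_left)
        then have "v = (1 / ((x \<bullet> v) / (v \<bullet> v))) *\<^sub>R x" by (subst e) simp
        then show False using x(1) vR by (metis span_scale)
      qed
    qed
  qed (rule subspace_span)
  have "independent (p ` R)" using linear_independent_injective_image[OF linp indR injp] .
  moreover have "card (p ` R) = k" using R(1) injp by (metis card_image inj_on_subset span_superset)
  ultimately have "\<exists>b g N. gs_reduced k b g N \<and> int_span (b ` {..<k}) = int_span (p ` R) \<and> (\<forall>i<k. g i \<in> span (p ` R))"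
    by (rule Suc.IH)
  then obtain b' g' N' where IH: "gs_reduced k b' g' N'" "int_span (b' ` {..<k}) = int_span (p ` R)"
    "\<forall>i<k. g' i \<in> span (p ` R)"
    by blast
  have bp: "int_span (b' ` {..<k}) = p ` int_span R"
    using IH(2) int_span_linear_image[OF linp] by metis
  have "\<exists>x. x \<in> int_span R \<and> p x = b' i" if "i < k" for i
  proof -
    have "b' i \<in> int_span (b' ` {..<k})" using that by (auto intro: int_module.span_base)
    then show ?thesis using bp by auto
  qed
  then obtain r where r: "\<And>i. i < k \<Longrightarrow> r i \<in> int_span R" "\<And>i. i < k \<Longrightarrow> p (r i) = b' i" by metis
  have pr: "p ` (r ` {..<k}) = b' ` {..<k}" using r(2) by (force simp: image_iff)
  have rR: "int_span (r ` {..<k}) \<subseteq> int_span R"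
    using r(1) by (metis (mono_tags, lifting) image_subsetI int_module.span_minimal int_module.subspace_span lessThan_iff)
  \<comment> \<open>The lifts \<open>r i\<close> generate all of the integral span of
    \<open>R\<close>: their projections generate its image under \<open>p\<close>, and
    \<open>p\<close> is injective there.\<close>
  have Rr: "R \<subseteq> int_span (r ` {..<k})"
  proof
    fix x assume "x \<in> R"
    then have x: "x \<in> int_span R" by (auto intro: int_module.span_base)
    then have "p x \<in> p ` int_span (r ` {..<k})"
      using bp pr int_span_linear_image[OF linp, of "r ` {..<k}"] by auto
    then obtain y where y: "y \<in> int_span (r ` {..<k})" "p x = p y" by auto
    then have "x = y" using injp x rR int_span_subset_span[of R] by (meson inj_onD subsetD)
    then show "x \<in> int_span (r ` {..<k})" using y by simp
  qed
  \<comment> \<open>\<open>t i\<close> is the coefficient of \<open>r i\<close> along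
    \<open>v\<close>. Subtracting the rounded multiple of \<open>v\<close> keeps the projection and
    leaves a coefficient of absolute value at most 1/2. The new families put \<open>v\<close> at
    index 0 and shift the others by one.\<close>
  define t where "t i = (r i \<bullet> v) / (v \<bullet> v)" for i
  define m where "m i = round (t i)" for i
  define b where "b = case_nat v (\<lambda>i. r i - of_int (m i) *\<^sub>R v)"
  define g where "g = case_nat v g'"
  define N where "N i j = (case i of 0 \<Rightarrow> 0 | Suc i' \<Rightarrow> (case j of 0 \<Rightarrow> t i' - of_int (m i') | Suc j' \<Rightarrow> N' i' j'))" for i j
  have [simp]: "b 0 = v" "b (Suc i) = r i - of_int (m i) *\<^sub>R v" "g 0 = v" "g (Suc i) = g' i"
    "N (Suc i) 0 = t i - of_int (m i)" "N (Suc i) (Suc j) = N' i j" for i j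
    by (simp_all add: b_def g_def N_def)
  have bA: "b ` {..<Suc k} = insert v ((\<lambda>i. r i - of_int (m i) *\<^sub>R v) ` {..<k})"
    unfolding lessThan_Suc_eq_insert_0 by (simp add: image_image)
  have "int_span (b ` {..<Suc k}) = int_span (insert v R)"
    unfolding int_module.span_eq
  proof (intro conjI)
    have "r i - of_int (m i) *\<^sub>R v \<in> int_span (insert v R)" if "i < k" for i
      using r(1)[OF that] int_module.span_mono[of R "insert v R"]
      by (auto intro!: int_module.span_diff int_module.span_scale intro: int_module.span_base)
    then show "b ` {..<Suc k} \<subseteq> int_span (insert v R)"
      unfolding bA by (auto intro: int_module.span_base)
    have vb: "v \<in> int_span (b ` {..<Suc k})"
      unfolding bA by (auto intro: int_module.span_base)
    have "r i \<in> int_span (b ` {..<Suc k})" if "i < k" for i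
    proof -
      have "b (Suc i) + of_int (m i) *\<^sub>R v \<in> int_span (b ` {..<Suc k})"
        by (intro int_module.span_add int_module.span_scale vb int_module.span_base)
           (use that in \<open>auto simp: bA\<close>)
      then show ?thesis by simp
    qed
    then have "r ` {..<k} \<subseteq> int_span (b ` {..<Suc k})" by auto
    then have "int_span (r ` {..<k}) \<subseteq> int_span (b ` {..<Suc k})"
      by (intro int_module.span_minimal int_module.subspace_span)
    then show "insert v R \<subseteq> int_span (b ` {..<Suc k})" using Rr vb by auto
  qed
  then have bS: "int_span (b ` {..<Suc k}) = int_span S" using R(4) by simp
  \<comment> \<open>The span clause of the induction hypothesis enters here: \<open>g' i\<close>
    lies in the image of \<open>p\<close> and is therefore orthogonal to \<open>v\<close>.\<close>
  have g'p: "\<exists>y\<in>span R. g' i = p y" if "i < k" for i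
    using IH(3) that linear_span_image[OF linp, of R] by auto
  then have g'v: "g' i \<bullet> v = 0" if "i < k" for i using g'p[OF that] pv by auto
  have spS: "span (insert v R) = span S" using R(4) span_int_span by metis
  have gS: "g i \<in> span S" if i: "i < Suc k" for i
  proof (cases i)
    case 0 then show ?thesis by (simp add: spS[symmetric] span_base)
  next
    case (Suc j)
    then obtain y where y: "y \<in> span R" "g' j = p y" using g'p[of j] i Suc by auto
    then have "y \<in> span (insert v R)" using span_mono[of R "insert v R"] by auto
    then show ?thesis unfolding Suc spS[symmetric] by (simp add: y p_def span_diff span_scale span_base)
  qed
  have bdec: "b (Suc i) = b' i + (t i - of_int (m i)) *\<^sub>R v" if "i < k" for i
    using r(2)[OF that, symmetric] by (simp add: p_def t_def algebra_simps)
  have "gs_reduced (Suc k) b g N"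
    unfolding gs_reduced_def
  proof (intro conjI allI impI)
    fix i assume i: "i < Suc k"
    show "g i \<noteq> 0" using i IH(1) v0 by (cases i) (auto simp: gs_reduced_def)
    show "b i = g i + (\<Sum>j<i. N i j *\<^sub>R g j)"
    proof (cases i)
      case (Suc j)
      then have "b i = g' j + (\<Sum>l<j. N' j l *\<^sub>R g' l) + (t j - of_int (m j)) *\<^sub>R v"
        using bdec[of j] i IH(1) by (simp add: gs_reduced_def)
      then show ?thesis unfolding Suc by (subst sum.lessThan_Suc_shift) simp
    qed simp
    fix j
    show "g i \<bullet> g j = 0" if "j < Suc k" "i \<noteq> j"
      using that i IH(1) g'v by (cases i; cases j) (auto simp: gs_reduced_def inner_commute)
    show "\<bar>N i j\<bar> \<le> 1/2" if "j < i"
    proof (cases i)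
      case (Suc l)
      then show ?thesis
        using that i IH(1) of_int_round_abs_le[of "t l"] by (cases j) (auto simp: gs_reduced_def m_def abs_minus_commute)
    qed (use that in auto)
  next
    fix i assume i: "Suc i < Suc k"
    show "(norm (g i))\<^sup>2 \<le> 4/3 * (norm (g (Suc i)))\<^sup>2"
    proof (cases i)
      case (Suc j)
      then show ?thesis using i IH(1) by (simp add: gs_reduced_def)
    next
      case 0
      have ind: "inj_on b {..<Suc k}" "independent (b ` {..<Suc k})"
        using independent_if_same_int_span[OF Suc.prems bS] by auto
      \<comment> \<open>Removing \<open>b 1\<close> from the new basis shows that it belongs to
        \<open>C\<close>, so |v| <= |b 1|. Since \<open>b 1\<close> is \<open>g' 0\<close> plus at
        most half of \<open>v\<close>, Pythagoras gives 3/4 |v|^2 <= |g' 0|^2.\<close>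
      let ?R = "b ` ({..<Suc k} - {1})"
      have "{..<Suc k} = insert 1 ({..<Suc k} - {1})" using i 0 by auto
      then have "b ` {..<Suc k} = insert (b 1) ?R" by (metis image_insert)
      moreover have "b 1 \<notin> ?R" using ind(1) i 0 by (auto simp: inj_on_def)
      moreover have "card ?R = k"
        using ind(1) i 0 by (subst card_image) (auto intro: inj_on_subset)
      ultimately have "b 1 \<in> C" unfolding C_def using ind(2) bS by (auto intro!: exI[of _ ?R])
      then have "norm v \<le> norm (b 1)" by (rule vmin)
      then have "(norm v)\<^sup>2 \<le> (norm (b 1))\<^sup>2" by (simp add: power_mono)
      also have "b 1 = g' 0 + N 1 0 *\<^sub>R v"
        using bdec[of 0] i 0 IH(1) by (simp add: gs_reduced_def)
      also have "(norm \<dots>)\<^sup>2 = (norm (g' 0))\<^sup>2 + (N 1 0)\<^sup>2 * (norm v)\<^sup>2"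
        unfolding power2_norm_eq_inner
        using g'v[of 0] i 0 by (simp add: inner_add inner_commute power2_eq_square)
      also have "\<dots> \<le> (norm (g' 0))\<^sup>2 + (1/2)\<^sup>2 * (norm v)\<^sup>2"
      proof -
        have "\<bar>N 1 0\<bar> \<le> 1/2" using of_int_round_abs_le[of "t 0"] by (simp add: m_def abs_minus_commute)
        then have "(N 1 0)\<^sup>2 \<le> (1/2)\<^sup>2" by (rule power2_le_iff_abs_le[THEN iffD2, rotated]) simp
        then show ?thesis by (intro add_left_mono mult_right_mono) auto
      qed
      finally show ?thesis using 0 by (simp add: power2_eq_square)
    qed
  qed
  then show ?case using bS gS by blast
qed


subsection \<open>Bounds for reduced bases\<close>

text \<open>The unitriangular transition matrix from \<open>g\<close> to \<open>b\<close>, padded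
  with zeros so that sums in both directions run over the full index range.\<close>

definition gs_coeff :: "(nat \<Rightarrow> nat \<Rightarrow> real) \<Rightarrow> nat \<Rightarrow> nat \<Rightarrow> real" where
  "gs_coeff N i j = (if j = i then 1 else if j < i then N i j else 0)"

lemma gs_reduced_basis_eq:
  assumes "gs_reduced n b g N" "i < n"
  shows "b i = (\<Sum>j<n. gs_coeff N i j *\<^sub>R g j)"
proof -
  have "(\<Sum>j<n. gs_coeff N i j *\<^sub>R g j) = (\<Sum>j<Suc i. gs_coeff N i j *\<^sub>R g j)"
    using assms(2) by (intro sum.mono_neutral_right) (auto simp: gs_coeff_def)
  also have "\<dots> = b i"
    using assms by (auto simp: gs_reduced_def gs_coeff_def)
  finally show ?thesis ..
qed

lemma abs_gs_coeff_le:
  assumes "gs_reduced n b g N" "i < n" shows "\<bar>gs_coeff N i j\<bar> \<le> 1"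
  using assms by (force simp: gs_reduced_def gs_coeff_def)

text \<open>Since 4/3 <= 4, each step to the next index costs at most a factor 2, and there are
  fewer than n steps.\<close>

lemma gs_reduced_norm_le:
  assumes "gs_reduced n b g N" "i \<le> j" "j < n" shows "norm (g i) \<le> 2 ^ n * norm (g j)"
proof -
  have "norm (g i) \<le> 2 ^ (j - i) * norm (g j)" using assms(2,3)
  proof (induction j rule: dec_induct)
    case (step j)
    have "(norm (g j))\<^sup>2 \<le> 4/3 * (norm (g (Suc j)))\<^sup>2" using step assms(1) by (simp add: gs_reduced_def)
    also have "\<dots> \<le> (2 * norm (g (Suc j)))\<^sup>2" by (simp add: power_mult_distrib)
    finally have "norm (g j) \<le> 2 * norm (g (Suc j))" by (rule power2_le_imp_le) simp
    moreover have "norm (g i) \<le> 2 ^ (j - i) * norm (g j)" using step by simp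
    ultimately have "norm (g i) \<le> 2 ^ (j - i) * (2 * norm (g (Suc j)))"
      by (meson mult_left_mono order_trans zero_le_numeral zero_le_power)
    then show ?case using step by (simp add: Suc_diff_le)
  qed simp
  also have "\<dots> \<le> 2 ^ n * norm (g j)" using assms by (intro mult_right_mono power_increasing) auto
  finally show ?thesis .
qed

lemma inner_linear_sums:
  assumes "linear f"
  shows "(\<Sum>k\<in>A. x k *\<^sub>R u k) \<bullet> f (\<Sum>l\<in>B. y l *\<^sub>R w l) = (\<Sum>k\<in>A. \<Sum>l\<in>B. x k * (y l * (u k \<bullet> f (w l))))"
  by (subst inner_sum_left)
    (simp add: linear_sum[OF assms] linear_scale[OF assms] inner_sum_right sum_distrib_left mult_ac)

locale gs_reduced_dual =
  fixes n :: nat and b g c :: "nat \<Rightarrow> 'a::euclidean_space" and N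
  assumes reduced: "gs_reduced n b g N" and span_b: "span (b ` {..<n}) = UNIV"
    and dual: "\<And>i j. i < n \<Longrightarrow> j < n \<Longrightarrow> c i \<bullet> b j = (if i = j then 1 else 0)"
begin

lemma gs_inner_basis:
  assumes "i < n" "j < n" shows "g i \<bullet> b j = gs_coeff N j i * (norm (g i))\<^sup>2"
proof -
  have "g i \<bullet> b j = (\<Sum>k<n. gs_coeff N j k * (g i \<bullet> g k))"
    by (simp add: gs_reduced_basis_eq[OF reduced assms(2)] inner_sum_right)
  also have "\<dots> = (\<Sum>k<n. if k = i then gs_coeff N j i * (norm (g i))\<^sup>2 else 0)"
    using reduced assms by (intro sum.cong) (auto simp: gs_reduced_def power2_norm_eq_inner)
  finally show ?thesis using assms by simp
qed

text \<open>Both sides have the same inner product with every \<open>b j\<close>, and these span the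
  space. Only terms with k >= i survive, so the dual basis is triangular in the opposite
  direction.\<close>

lemma gs_eq_dual_sum:
  assumes "i < n" shows "g i = (norm (g i))\<^sup>2 *\<^sub>R (\<Sum>k<n. gs_coeff N k i *\<^sub>R c k)"
proof -
  define x where "x = g i - (norm (g i))\<^sup>2 *\<^sub>R (\<Sum>k<n. gs_coeff N k i *\<^sub>R c k)"
  have "x \<bullet> b j = 0" if "j < n" for j
  proof -
    have "(\<Sum>k<n. gs_coeff N k i *\<^sub>R c k) \<bullet> b j = (\<Sum>k<n. if k = j then gs_coeff N j i else 0)"
      unfolding inner_sum_left using that by (intro sum.cong) (auto simp: dual)
    then show ?thesis
      using that assms by (simp add: x_def inner_diff_left gs_inner_basis)
  qed
  then have "orthogonal x y" if "y \<in> b ` {..<n}" for y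
    using that by (auto simp: orthogonal_def)
  then have "orthogonal x x" using orthogonal_to_span[of x "b ` {..<n}" x] span_b by auto
  then show ?thesis by (simp add: x_def orthogonal_self)
qed

text \<open>Solving the triangular relation for \<open>c k\<close> leaves \<open>g k\<close> divided
  by its squared norm and multiples of \<open>c l\<close> with l > k, hence an induction downwards
  from the last index. The comparison of \<open>g k\<close> with \<open>g l\<close> turns |c l| |g
  k| into the quantity already bounded, and each step multiplies the bound by 1 + n 2^n.\<close>

lemma norm_dual_le:
  assumes "k < n"
  shows "norm (c k) * norm (g k) \<le> (1 + real n * 2 ^ n) ^ (n - k)"
  using assms
proof (induction "n - k" arbitrary: k rule: less_induct)
  case less
  let ?Q = "1 + real n * 2 ^ n"
  have Q1: "1 \<le> ?Q" by simp
  have gk: "norm (g k) > 0" using less.prems reduced by (simp add: gs_reduced_def)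
  let ?s = "\<Sum>l\<in>{..<n}-{k}. gs_coeff N l k *\<^sub>R c l"
  have "g k = (norm (g k))\<^sup>2 *\<^sub>R (c k + ?s)"
    using gs_eq_dual_sum[OF less.prems] less.prems by (simp add: sum.remove[of _ k] gs_coeff_def)
  then have "(1 / (norm (g k))\<^sup>2) *\<^sub>R g k = (1 / (norm (g k))\<^sup>2) *\<^sub>R (norm (g k))\<^sup>2 *\<^sub>R (c k + ?s)"
    by (rule arg_cong)
  then have "c k = (1 / (norm (g k))\<^sup>2) *\<^sub>R g k - ?s" using gk by (simp add: algebra_simps)
  then have "norm (c k) \<le> norm ((1 / (norm (g k))\<^sup>2) *\<^sub>R g k) + norm ?s" by (metis norm_triangle_ineq4)
  then have "norm (c k) * norm (g k) \<le> (norm ((1 / (norm (g k))\<^sup>2) *\<^sub>R g k) + norm ?s) * norm (g k)"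
    using gk by (intro mult_right_mono) auto
  also have "\<dots> = 1 + norm ?s * norm (g k)" using gk by (simp add: distrib_right power2_eq_square)
  also have "\<dots> \<le> 1 + (\<Sum>l\<in>{..<n}-{k}. norm (gs_coeff N l k *\<^sub>R c l)) * norm (g k)"
    by (intro add_left_mono mult_right_mono norm_sum) auto
  also have "\<dots> = 1 + (\<Sum>l\<in>{..<n}-{k}. norm (gs_coeff N l k *\<^sub>R c l) * norm (g k))"
    by (simp add: sum_distrib_right)
  also have "\<dots> \<le> 1 + (\<Sum>l\<in>{..<n}-{k}. 2 ^ n * ?Q ^ (n - k - 1))"
  proof (intro add_left_mono sum_mono)
    fix l assume l: "l \<in> {..<n}-{k}"
    show "norm (gs_coeff N l k *\<^sub>R c l) * norm (g k) \<le> 2 ^ n * ?Q ^ (n - k - 1)"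
    proof (cases "k < l")
      case True
      have "norm (gs_coeff N l k *\<^sub>R c l) * norm (g k) \<le> (1 * norm (c l)) * (2 ^ n * norm (g l))"
        unfolding norm_scaleR real_norm_def
        using l True abs_gs_coeff_le[OF reduced] gs_reduced_norm_le[OF reduced, of k l]
        by (intro mult_mono) auto
      also have "\<dots> = 2 ^ n * (norm (c l) * norm (g l))" by simp
      also have "\<dots> \<le> 2 ^ n * ?Q ^ (n - l)"
        using less.hyps[of l] l True by (intro mult_left_mono) auto
      also have "\<dots> \<le> 2 ^ n * ?Q ^ (n - k - 1)"
        using True Q1 by (intro mult_left_mono power_increasing) auto
      finally show ?thesis .
    next
      case False
      then show ?thesis using l by (auto simp: gs_coeff_def)
    qed
  qed
  also have "\<dots> = 1 + real (n - 1) * (2 ^ n * ?Q ^ (n - k - 1))" using less.prems by simp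
  \<comment> \<open>The leading 1 is enlarged to a power of \<open>?Q\<close>, so that the two terms
    combine to one further factor \<open>?Q\<close>.\<close>
  also have "\<dots> \<le> ?Q ^ (n - k - 1) + real n * (2 ^ n * ?Q ^ (n - k - 1))"
    using Q1 by (intro add_mono mult_right_mono one_le_power) auto
  also have "\<dots> = ?Q ^ Suc (n - k - 1)" by (simp add: algebra_simps)
  also have "Suc (n - k - 1) = n - k" using less.prems by simp
  finally show ?case by simp
qed

text \<open>If every product of norms \<open>|c k| |c l|\<close> with \<open>k \<ge> i\<close> and \<open>l \<ge> j\<close> is below 1, the integers
  \<open>c k \<bullet> f (c l)\<close> vanish, and with them \<open>g i \<bullet> f (g j)\<close>; otherwise \<open>|g i| |g j|\<close> is bounded.\<close>

lemma inner_gs_le: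
  assumes f: "orthogonal_transformation f"
    and int: "\<And>k l. k < n \<Longrightarrow> l < n \<Longrightarrow> c k \<bullet> f (c l) \<in> \<int>" and ij: "i < n" "j < n"
  shows "\<bar>g i \<bullet> f (g j)\<bar> \<le> (2 ^ n * (1 + real n * 2 ^ n) ^ n)\<^sup>2"
proof -
  have linf: "linear f" and nf: "norm (f x) = norm x" for x
    using f orthogonal_transformation_linear orthogonal_transformation_norm by auto
  let ?Q = "1 + real n * 2 ^ n"
  have Q1: "1 \<le> ?Q" by simp
  show ?thesis
  proof (cases "\<exists>k l. i \<le> k \<and> j \<le> l \<and> k < n \<and> l < n \<and> 1 \<le> norm (c k) * norm (c l)")
    case True
    then obtain k l where kl: "i \<le> k" "j \<le> l" "k < n" "l < n" "1 \<le> norm (c k) * norm (c l)" by auto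
    have u: "norm (c k) * norm (g k) \<le> ?Q ^ n" if "k < n" for k
      by (rule order_trans[OF norm_dual_le[OF that] power_increasing]) auto
    have "\<bar>g i \<bullet> f (g j)\<bar> \<le> norm (g i) * norm (g j)"
      using Cauchy_Schwarz_ineq2[of "g i" "f (g j)"] nf by simp
    also have "\<dots> \<le> (2 ^ n * norm (g k)) * (2 ^ n * norm (g l))"
      using gs_reduced_norm_le[OF reduced] kl by (intro mult_mono) auto
    \<comment> \<open>Multiplying by |c k| |c l|, which is at least 1, forms the products |c k| |g
      k| and |c l| |g l| bounded by \<open>norm_dual_le\<close>.\<close>
    also have "\<dots> \<le> (norm (c k) * norm (c l)) * ((2 ^ n * norm (g k)) * (2 ^ n * norm (g l)))"
      using mult_right_mono[OF kl(5)] by simp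
    also have "\<dots> = (2 ^ n)\<^sup>2 * ((norm (c k) * norm (g k)) * (norm (c l) * norm (g l)))"
      by (simp add: power2_eq_square)
    also have "\<dots> \<le> (2 ^ n)\<^sup>2 * (?Q ^ n * ?Q ^ n)"
      using u kl by (intro mult_left_mono mult_mono) auto
    finally show ?thesis by (simp add: power2_eq_square mult_ac)
  next
    case False
    have "gs_coeff N k i * (gs_coeff N l j * (c k \<bullet> f (c l))) = 0" if "k < n" "l < n" for k l
    proof (cases "i \<le> k \<and> j \<le> l")
      case True
      have "\<bar>c k \<bullet> f (c l)\<bar> \<le> norm (c k) * norm (c l)"
        using Cauchy_Schwarz_ineq2[of "c k" "f (c l)"] nf by simp
      also have "\<dots> < 1" using False True that by force
      finally have "c k \<bullet> f (c l) = 0" using int[OF that] Ints_nonzero_abs_less1 by blast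
      then show ?thesis by simp
    qed (auto simp: gs_coeff_def)
    then have "(\<Sum>k<n. \<Sum>l<n. gs_coeff N k i * (gs_coeff N l j * (c k \<bullet> f (c l)))) = 0"
      by (intro sum.neutral ballI) auto
    then have "(\<Sum>k<n. gs_coeff N k i *\<^sub>R c k) \<bullet> f (\<Sum>l<n. gs_coeff N l j *\<^sub>R c l) = 0"
      by (simp add: inner_linear_sums[OF linf])
    moreover have "g i \<bullet> f (g j) = (norm (g i))\<^sup>2 * ((norm (g j))\<^sup>2 * ((\<Sum>k<n. gs_coeff N k i *\<^sub>R c k) \<bullet> f (\<Sum>l<n. gs_coeff N l j *\<^sub>R c l)))"
      by (subst (1) gs_eq_dual_sum[OF ij(1)], subst (1) gs_eq_dual_sum[OF ij(2)])
        (simp add: linear_scale[OF linf])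
    ultimately show ?thesis by simp
  qed
qed

text \<open>Expanding both basis vectors in \<open>g\<close> gives n^2 terms whose coefficients have
  absolute value at most 1.\<close>

lemma inner_basis_le:
  assumes f: "orthogonal_transformation f"
    and int: "\<And>k l. k < n \<Longrightarrow> l < n \<Longrightarrow> c k \<bullet> f (c l) \<in> \<int>" and ij: "i < n" "j < n"
  shows "\<bar>b i \<bullet> f (b j)\<bar> \<le> real n * (real n * (2 ^ n * (1 + real n * 2 ^ n) ^ n)\<^sup>2)"
proof -
  have linf: "linear f" using f by (rule orthogonal_transformation_linear)
  let ?K = "(2 ^ n * (1 + real n * 2 ^ n) ^ n)\<^sup>2"
  have "b i \<bullet> f (b j) = (\<Sum>k<n. \<Sum>l<n. gs_coeff N i k * (gs_coeff N j l * (g k \<bullet> f (g l))))"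
    by (simp add: gs_reduced_basis_eq[OF reduced] ij inner_linear_sums[OF linf])
  also have "\<bar>\<dots>\<bar> \<le> (\<Sum>k<n. \<Sum>l<n. 1 * (1 * ?K))"
  proof (rule order_trans[OF sum_abs], rule sum_mono, rule order_trans[OF sum_abs], rule sum_mono)
    fix k l assume "k \<in> {..<n}" "l \<in> {..<n}"
    then show "\<bar>gs_coeff N i k * (gs_coeff N j l * (g k \<bullet> f (g l)))\<bar> \<le> 1 * (1 * ?K)"
      unfolding abs_mult
      using abs_gs_coeff_le[OF reduced ij(1)] abs_gs_coeff_le[OF reduced ij(2)] inner_gs_le[OF f int]
      by (intro mult_mono) auto
  qed
  finally show ?thesis by simp
qed

end


subsection \<open>Matrices of isodual lattices\<close>

lemma matrix_inv_inverse:
  assumes "invertible A" shows "A ** matrix_inv A = mat 1" "matrix_inv A ** A = mat 1"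
  using someI_ex[OF assms[unfolded invertible_def]] by (auto simp: matrix_inv_def)

text \<open>The generality covers integral matrices, where invertible means unimodular.\<close>

lemma invertible_transpose_comm_semiring:
  fixes A :: "'a::comm_semiring_1^'n^'n"
  assumes "invertible A" shows "invertible (transpose A)"
proof -
  obtain B where "A ** B = mat 1" "B ** A = mat 1" using assms by (auto simp: invertible_def)
  then have "transpose B ** transpose A = mat 1" "transpose A ** transpose B = mat 1"
    by (metis matrix_transpose_mul transpose_mat)+
  then show ?thesis by (auto simp: invertible_def)
qed

lemma invertible_mult_semiring:
  fixes A :: "'a::semiring_1^'n^'n"
  assumes "invertible A" "invertible B" shows "invertible (A ** B)"
proof -
  obtain A' B' where "A ** A' = mat 1" "A' ** A = mat 1" "B ** B' = mat 1" "B' ** B = mat 1"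
    using assms by (auto simp: invertible_def)
  then have "(A ** B) ** (B' ** A') = mat 1" "(B' ** A') ** (A ** B) = mat 1"
    by (metis matrix_mul_assoc matrix_mul_rid)+
  then show ?thesis by (auto simp: invertible_def)
qed

lemma row_matrix_mult_transpose:
  fixes A B :: "real^'n^'n" shows "(A ** transpose B) $ i $ j = row i A \<bullet> row j B"
  by (simp add: matrix_matrix_mult_def transpose_def row_def inner_vec_def)

lemma row_matrix_congruence:
  fixes B S :: "real^'n^'n" shows "(B ** S ** transpose B) $ i $ j = row i B \<bullet> (S *v row j B)"
proof -
  have "(B ** S ** transpose B) $ i $ j = (B ** transpose (B ** transpose S)) $ i $ j"
    by (simp add: matrix_transpose_mul matrix_mul_assoc)
  also have "\<dots> = row i B \<bullet> row j (B ** transpose S)" by (rule row_matrix_mult_transpose)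
  also have "row j (B ** transpose S) = S *v row j B"
    by (simp add: vec_eq_iff row_def matrix_vector_mult_def matrix_matrix_mult_def transpose_def mult.commute)
  finally show ?thesis .
qed

lemma orthogonal_transformation_matrix_vector_mult:
  fixes S :: "real^'n^'n"
  assumes "orthogonal_matrix S" shows "orthogonal_transformation ((*v) S)"
  using assms by (simp add: orthogonal_transformation_matrix matrix_of_matrix_vector_mul)

lemma inner_gram:
  fixes G :: "real^'n^'m" shows "x \<bullet> ((G ** transpose G) *v x) = (norm (transpose G *v x))\<^sup>2"
  by (simp add: power2_norm_eq_inner transpose_matrix_vector flip: matrix_vector_mul_assoc dot_lmul_matrix)

lemma posdef_gram:
  assumes "invertible (G :: real^'n^'n)" shows "posdef (G ** transpose G)"
  unfolding posdef_def
proof (intro conjI allI impI)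
  fix x :: "real^'n" assume "x \<noteq> 0"
  moreover have "inj ((*v) (transpose G))"
    by (rule inj_matrix_vector_mult) (rule transpose_invertible[OF assms])
  ultimately have "transpose G *v x \<noteq> 0" by (metis injD matrix_vector_mult_0_right)
  then show "0 < x \<bullet> ((G ** transpose G) *v x)" by (simp add: inner_gram)
qed (simp add: matrix_transpose_mul)

lemma posdef_invertible:
  assumes "posdef A" shows "invertible A"
proof -
  have "A *v x \<noteq> 0" if "x \<noteq> 0" for x using assms that by (force simp: posdef_def)
  then show ?thesis by (metis invertible_left_inverse matrix_left_invertible_ker)
qed

text \<open>With \<open>C\<^sup>2 = A\<close>, the matrix \<open>G = C\<inverse>FC\<inverse>\<close> is normal, so a fourth root \<open>Q\<close> of \<open>GG'\<close> commutes
  with \<open>G\<close>, and \<open>Q\<inverse>GQ\<inverse>\<close> is orthogonal.\<close>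

lemma orthogonal_congruence_if_invariant:
  fixes F M A :: "real^'n^'n"
  assumes F: "invertible F" and MF: "M ** transpose F = F"
    and A: "posdef A" and MA: "M ** A ** transpose M = A"
  obtains B S :: "real^'n^'n" where "invertible B" "orthogonal_matrix S" "F = B ** S ** transpose B"
proof -
  note r = matrix_mul_assoc[symmetric]
  obtain C where C: "posdef C" "C ** C = A" using posdef_sqrt[OF A] by metis
  define Ci where "Ci = matrix_inv C"
  have iC: "invertible C" using C(1) by (rule posdef_invertible)
  then have [simp]: "C ** Ci = mat 1" "Ci ** C = mat 1" using matrix_inv_inverse by (auto simp: Ci_def)
  then have iCi: "invertible Ci" unfolding invertible_def by blast
  have [simp]: "C ** (Ci ** X) = X" "Ci ** (C ** X) = X" for X :: "real^'n^'n"
    by (simp_all add: matrix_mul_assoc)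
  have tC [simp]: "transpose C = C" using C(1) by (simp add: posdef_def)
  have tCi [simp]: "transpose Ci = Ci"
  proof -
    have "transpose (C ** Ci) = mat 1" by simp
    then have "transpose Ci ** C = mat 1" by (simp add: matrix_transpose_mul del: \<open>C ** Ci = mat 1\<close>)
    then have "transpose Ci ** C ** Ci = Ci" by simp
    then show ?thesis by (simp add: r)
  qed
  define G where "G = Ci ** F ** Ci"
  \<comment> \<open>\<open>X\<close> is \<open>M\<close> in coordinates where the invariant form
    \<open>A\<close> becomes the standard one, so invariance of \<open>A\<close> says that
    \<open>X\<close> is orthogonal.\<close>
  define X where "X = Ci ** M ** C"
  have tG: "transpose G = Ci ** transpose F ** Ci" by (simp add: G_def matrix_transpose_mul r)
  have XX: "X ** transpose X = mat 1"
  proof -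
    have "X ** transpose X = Ci ** (M ** (C ** C) ** transpose M) ** Ci"
      by (simp add: X_def matrix_transpose_mul r)
    also have "\<dots> = mat 1" by (simp add: C(2) MA) (simp add: C(2)[symmetric] r)
    finally show ?thesis .
  qed
  have XX': "transpose X ** X = mat 1" using XX matrix_left_right_inverse by blast
  have GX: "G = X ** transpose G"
  proof -
    have "X ** transpose G = Ci ** (M ** transpose F) ** Ci" by (simp add: X_def tG r)
    then show ?thesis by (simp add: MF G_def)
  qed
  then have GX': "transpose G = G ** transpose X" by (metis matrix_transpose_mul transpose_transpose)
  define H where "H = G ** transpose G"
  \<comment> \<open>From G = X G' and its transpose G' = G X', the orthogonal factors meet in the
    middle of G' G and cancel.\<close>
  have normal: "transpose G ** G = H"
  proof -
    have "transpose G ** G = (G ** transpose X) ** (X ** transpose G)" using GX GX' by simp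
    also have "\<dots> = G ** ((transpose X ** X) ** transpose G)" by (simp add: r)
    finally show ?thesis by (simp add: XX' H_def)
  qed
  have iG: "invertible G" unfolding G_def by (intro invertible_mult iCi F)
  obtain P where P: "posdef P" "P ** P = H" "G ** H = H ** G \<Longrightarrow> G ** P = P ** G"
    using posdef_sqrt[OF posdef_gram[OF iG]] unfolding H_def by metis
  have "G ** H = H ** G" by (metis H_def normal matrix_mul_assoc)
  then have GP: "G ** P = P ** G" by (rule P(3))
  obtain Q where Q: "posdef Q" "Q ** Q = P" "G ** P = P ** G \<Longrightarrow> G ** Q = Q ** G"
    using posdef_sqrt[OF P(1)] by metis
  have GQ: "G ** Q = Q ** G" using GP by (rule Q(3))
  define Qi where "Qi = matrix_inv Q"
  have iQ: "invertible Q" using Q(1) by (rule posdef_invertible)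
  then have [simp]: "Q ** Qi = mat 1" "Qi ** Q = mat 1" using matrix_inv_inverse by (auto simp: Qi_def)
  have [simp]: "Q ** (Qi ** X) = X" "Qi ** (Q ** X) = X" for X :: "real^'n^'n"
    by (simp_all add: matrix_mul_assoc)
  have tQ [simp]: "transpose Q = Q" using Q(1) by (simp add: posdef_def)
  have tQi [simp]: "transpose Qi = Qi"
  proof -
    have "transpose (Q ** Qi) = mat 1" by simp
    then have "transpose Qi ** Q = mat 1" by (simp add: matrix_transpose_mul del: \<open>Q ** Qi = mat 1\<close>)
    then have "transpose Qi ** Q ** Qi = Qi" by simp
    then show ?thesis by (simp add: r)
  qed
  have GQi: "G ** Qi = Qi ** G"
  proof -
    have "Qi ** (G ** Q) ** Qi = Qi ** (Q ** G) ** Qi" using GQ by simp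
    then show ?thesis by (simp add: r)
  qed
  define S where "S = Qi ** G ** Qi"
  have GQiX: "G ** (Qi ** X) = Qi ** (G ** X)" for X
    using GQi by (simp add: matrix_mul_assoc)
  \<comment> \<open>\<open>Qi\<close> commutes with \<open>G\<close>, so all but the last
    \<open>Qi\<close> move to the left; the product is 1 because \<open>H\<close> is the fourth
    power of \<open>Q\<close>.\<close>
  have "S ** transpose S = Qi ** Qi ** Qi ** H ** Qi"
    by (simp add: S_def H_def matrix_transpose_mul r GQiX)
  also have "\<dots> = mat 1" by (simp add: P(2)[symmetric] Q(2)[symmetric] r)
  finally have "orthogonal_matrix S"
    unfolding orthogonal_matrix_def using matrix_left_right_inverse by blast
  moreover have "F = (C ** Q) ** S ** transpose (C ** Q)"
    by (simp add: S_def G_def matrix_transpose_mul r)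
  moreover have "invertible (C ** Q)" by (intro invertible_mult iC iQ)
  ultimately show ?thesis using that by blast
qed

section \<open>Integral matrices as real matrices, and contragredients\<close>

lemma real_matrix_mult: "real_matrix (A ** B) = real_matrix A ** real_matrix B"
  by (simp add: real_matrix_def map_matrix_def matrix_matrix_mult_def)

lemma real_matrix_transpose: "real_matrix (transpose A) = transpose (real_matrix A)"
  by (simp add: real_matrix_def map_matrix_def transpose_def)

lemma real_matrix_one: "real_matrix (mat 1) = mat 1"
  by (simp add: real_matrix_def map_matrix_def mat_def vec_eq_iff)

lemma real_matrix_nth: "real_matrix A $ i $ j = of_int (A $ i $ j)"
  by (simp add: real_matrix_def)

lemma real_matrix_inject: "real_matrix A = real_matrix B \<longleftrightarrow> A = B"
  by (simp add: real_matrix_def vec_eq_iff)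

lemma det_real_matrix: "det (real_matrix A) = of_int (det A)"
  by (simp add: det_def real_matrix_def)

lemma invertible_real_matrix: "F \<in> GLZ \<Longrightarrow> invertible (real_matrix F)"
  by (metis (mono_tags) GLZ_def invertible_def mem_Collect_eq real_matrix_mult real_matrix_one)

lemma GLZ_mult: "A \<in> GLZ \<Longrightarrow> B \<in> GLZ \<Longrightarrow> A ** B \<in> GLZ"
  by (simp add: GLZ_def invertible_mult_semiring)

lemma GLZ_transpose: "A \<in> GLZ \<Longrightarrow> transpose A \<in> GLZ"
  by (simp add: GLZ_def invertible_transpose_comm_semiring)

lemma GLZ_inverse:
  assumes "T \<in> GLZ" obtains U where "U \<in> GLZ" "T ** U = mat 1" "U ** T = mat 1"
  using assms unfolding GLZ_def invertible_def by auto

lemma contragredient_inverse: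
  assumes "F \<in> GLZ"
  shows "transpose F ** contragredient F = mat 1" "contragredient F ** transpose F = mat 1"
  using matrix_inv_inverse[of "transpose F"] GLZ_transpose[OF assms]
  by (auto simp: GLZ_def contragredient_def)

lemma contragredient_unique:
  assumes "F \<in> GLZ" "transpose F ** X = mat 1" shows "contragredient F = X"
  by (metis assms contragredient_inverse(2) matrix_mul_assoc matrix_mul_lid matrix_mul_rid)

text \<open>The transpose of T F T' is T F' T', which is inverted factor by factor. A change of
  basis by \<open>T\<close> acts on the dual basis by the transpose of \<open>U\<close>.\<close>

lemma contragredient_congruence:
  assumes F: "F \<in> GLZ" and T: "T \<in> GLZ" and U: "T ** U = mat 1" "U ** T = mat 1"
  shows "contragredient (T ** F ** transpose T) = transpose U ** contragredient F ** U"
proof (rule contragredient_unique)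
  show "T ** F ** transpose T \<in> GLZ" using F T by (intro GLZ_mult GLZ_transpose)
  have t: "transpose T ** transpose U = mat 1" using U(2) by (metis matrix_transpose_mul transpose_mat)
  have "transpose (T ** F ** transpose T) ** (transpose U ** contragredient F ** U)
      = T ** transpose F ** (transpose T ** transpose U) ** contragredient F ** U"
    by (simp add: matrix_transpose_mul matrix_mul_assoc)
  also have "\<dots> = T ** (transpose F ** contragredient F) ** U"
    by (simp add: t matrix_mul_assoc)
  also have "\<dots> = mat 1" by (simp add: contragredient_inverse[OF F] U)
  finally show "transpose (T ** F ** transpose T) ** (transpose U ** contragredient F ** U) = mat 1" .
qed

text \<open>Summing R R' over the powers R of M = F ** contragredient F in one period gives a
  positive definite matrix \<open>A\<close> with M A M' = A.\<close>

lemma has_finite_order_imp_orthogonal_congruence: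
  fixes F :: "int^'n^'n"
  assumes F: "F \<in> GLZ" and fin: "has_finite_order (F ** contragredient F)"
  obtains B S :: "real^'n^'n" where "invertible B" "orthogonal_matrix S" "real_matrix F = B ** S ** transpose B"
proof -
  define M where "M = F ** contragredient F"
  define R where "R k = real_matrix (((**) M ^^ k) (mat 1))" for k
  obtain p where p: "p > 0" "R p = R 0" using fin by (auto simp: has_finite_order_def M_def R_def)
  have R0: "R 0 = mat 1" by (simp add: R_def real_matrix_one)
  have RS: "R (Suc k) = real_matrix M ** R k" for k by (simp add: R_def real_matrix_mult)
  define A where "A = (\<Sum>k<p. R k ** transpose (R k))"
  have mult_sum: "X ** (\<Sum>k<p. f k) = (\<Sum>k<p. X ** f k)" for X :: "real^'n^'n" and f
    by (induction p) (simp_all add: matrix_add_ldistrib)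
  have sum_mult: "(\<Sum>k<p. f k) ** X = (\<Sum>k<p. f k ** X)" for X :: "real^'n^'n" and f
    by (simp add: vec_eq_iff matrix_matrix_mult_def sum_distrib_right) (intro allI sum.swap)
  have trans_sum: "transpose (\<Sum>k<p. f k) = (\<Sum>k<p. transpose (f k))" for f :: "nat \<Rightarrow> real^'n^'n"
    by (simp add: vec_eq_iff transpose_def)
  have vec_sum: "(\<Sum>k<p. f k) *v x = (\<Sum>k<p. f k *v x)" for f :: "nat \<Rightarrow> real^'n^'n" and x
    by (induction p) (simp_all add: matrix_vector_mult_add_rdistrib)
  have "posdef A"
    unfolding posdef_def
  proof (intro conjI allI impI)
    show "transpose A = A" by (simp add: A_def trans_sum matrix_transpose_mul)
    fix x :: "real^'n" assume x: "x \<noteq> 0"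
    \<comment> \<open>The summand of the zeroth power is already positive and the others are
      nonnegative.\<close>
    have "0 < (norm (transpose (R 0) *v x))\<^sup>2" using x by (simp add: R0)
    also have "\<dots> \<le> (\<Sum>k<p. (norm (transpose (R k) *v x))\<^sup>2)"
      using p by (intro member_le_sum) auto
    also have "\<dots> = x \<bullet> (A *v x)" by (simp add: A_def vec_sum inner_sum_right inner_gram)
    finally show "0 < x \<bullet> (A *v x)" .
  qed
  moreover have "real_matrix M ** A ** transpose (real_matrix M) = A"
  proof -
    have "real_matrix M ** A ** transpose (real_matrix M) = (\<Sum>k<p. R (Suc k) ** transpose (R (Suc k)))"
      by (simp add: A_def mult_sum sum_mult RS matrix_transpose_mul matrix_mul_assoc)
    \<comment> \<open>The shift drops the term of index 0 and adds that of index p, and these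
      agree.\<close>
    also have "\<dots> = A"
      using sum.lessThan_Suc_shift[of "\<lambda>k. R k ** transpose (R k)" p]
        sum.lessThan_Suc[of "\<lambda>k. R k ** transpose (R k)" p] p(2)
      by (simp add: A_def)
    finally show ?thesis .
  qed
  moreover have "M ** transpose F = F"
    by (simp add: M_def contragredient_inverse[OF F] flip: matrix_mul_assoc)
  then have "real_matrix M ** transpose (real_matrix F) = real_matrix F"
    by (metis real_matrix_mult real_matrix_transpose)
  ultimately show ?thesis
    using orthogonal_congruence_if_invariant[OF invertible_real_matrix[OF F]] that by metis
qed

lemma finite_bounded_int_matrices: "finite {F :: int^'n^'m. \<forall>i j. \<bar>F $ i $ j\<bar> \<le> K}"
proof -
  have v: "finite {x :: 'a^'k. \<forall>i. x $ i \<in> A}" if "finite A" for A :: "'a set"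
  proof -
    have "finite (PiE (UNIV :: 'k set) (\<lambda>_. A))" using that by (intro finite_PiE) auto
    moreover have "{x :: 'a^'k. \<forall>i. x $ i \<in> A} \<subseteq> vec_lambda ` PiE UNIV (\<lambda>_. A)"
    proof
      fix x :: "'a^'k" assume "x \<in> {x. \<forall>i. x $ i \<in> A}"
      then show "x \<in> vec_lambda ` PiE UNIV (\<lambda>_. A)" by (intro image_eqI[of _ _ "vec_nth x"]) auto
    qed
    ultimately show ?thesis by (meson finite_imageI finite_subset)
  qed
  have "finite {F :: int^'n^'m. \<forall>i. F $ i \<in> {x. \<forall>j. x $ j \<in> {-K..K}}}" by (intro v) auto
  then show ?thesis by (rule rev_finite_subset) (auto simp: abs_le_iff minus_le_iff)
qed

text \<open>Conjugation by \<open>B\<close> turns the powers of \<open>M\<close> into orthogonal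
  matrices, so their entries are uniformly bounded. Being integral, they repeat, and invertibility
  turns a repetition into a power equal to 1.\<close>

lemma orthogonal_congruence_imp_has_finite_order:
  fixes F :: "int^'n^'n" and B S :: "real^'n^'n"
  assumes F: "F \<in> GLZ" and B: "invertible B" and S: "orthogonal_matrix S"
    and FB: "real_matrix F = B ** S ** transpose B"
  shows "has_finite_order (F ** contragredient F)"
proof -
  note r = matrix_mul_assoc[symmetric]
  define M where "M = F ** contragredient F"
  define W where "W k = ((**) M ^^ k) (mat 1)" for k
  have SS: "transpose S ** S = mat 1" using S by (simp add: orthogonal_matrix_def)
  obtain Bi where Bi: "B ** Bi = mat 1" "Bi ** B = mat 1" using B by (auto simp: invertible_def)
  have tBi: "transpose B ** transpose Bi = mat 1" using Bi(2) by (metis matrix_transpose_mul transpose_mat)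
  \<comment> \<open>Substituting F = B S B' into M F' = F and cancelling B' and S' on the right
    gives M B = B S S.\<close>
  have MB: "real_matrix M ** B = B ** (S ** S)"
  proof -
    have "M ** transpose F = F" by (simp add: M_def contragredient_inverse[OF F] r)
    then have "real_matrix M ** transpose (real_matrix F) = real_matrix F"
      by (metis real_matrix_mult real_matrix_transpose)
    then have "real_matrix M ** (B ** (transpose S ** transpose B)) ** transpose Bi ** S
        = B ** S ** transpose B ** transpose Bi ** S"
      by (simp add: FB matrix_transpose_mul r)
    then have "real_matrix M ** B ** (transpose S ** (transpose B ** transpose Bi) ** S)
        = B ** S ** (transpose B ** transpose Bi) ** S"
      by (simp add: r)
    then show ?thesis by (simp add: tBi SS r)
  qed
  have "\<exists>U. orthogonal_matrix U \<and> real_matrix (W k) ** B = B ** U" for k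
  proof (induction k)
    case 0
    then show ?case using orthogonal_matrix_id by (auto simp: W_def real_matrix_one)
  next
    case (Suc k)
    then obtain U where U: "orthogonal_matrix U" "real_matrix (W k) ** B = B ** U" by auto
    have "real_matrix (W (Suc k)) ** B = real_matrix M ** (real_matrix (W k) ** B)"
      by (simp add: W_def real_matrix_mult r)
    also have "\<dots> = B ** (S ** S ** U)" unfolding U(2) by (simp add: matrix_mul_assoc MB)
    finally show ?case using U(1) S by (metis orthogonal_matrix_mul)
  qed
  then obtain U where U: "\<And>k. orthogonal_matrix (U k)" "\<And>k. real_matrix (W k) ** B = B ** U k" by metis
  \<comment> \<open>An entry of B U B^-1 is the inner product of a row of \<open>B\<close> with the
    image under U of a column of \<open>Bi\<close>; by Cauchy-Schwarz this bound is the same for all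
    orthogonal U.\<close>
  define K where "K = Max (range (\<lambda>(i, j). norm (row i B) * norm (row j (transpose Bi))))"
  have "\<bar>W k $ i $ j\<bar> \<le> \<lceil>K\<rceil>" for k i j
  proof -
    have "real_matrix (W k) = B ** transpose (transpose Bi ** transpose (U k))"
      using U(2)[of k] Bi by (simp add: matrix_transpose_mul) (metis matrix_mul_assoc matrix_mul_rid)
    then have "of_int (W k $ i $ j) = (B ** transpose (transpose Bi ** transpose (U k))) $ i $ j"
      by (metis real_matrix_nth)
    also have "\<dots> = row i B \<bullet> row j (transpose Bi ** transpose (U k))"
      by (rule row_matrix_mult_transpose)
    also have "row j (transpose Bi ** transpose (U k)) = U k *v row j (transpose Bi)"
      by (simp add: vec_eq_iff row_def matrix_vector_mult_def matrix_matrix_mult_def transpose_def mult.commute)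
    also have "\<bar>row i B \<bullet> \<dots>\<bar> \<le> norm (row i B) * norm (row j (transpose Bi))"
      using Cauchy_Schwarz_ineq2[of "row i B"] orthogonal_transformation_matrix_vector_mult[OF U(1)[of k]]
      by (metis orthogonal_transformation_norm)
    also have "\<dots> \<le> K" unfolding K_def by (rule Max_ge) (auto intro!: image_eqI[of _ _ "(i, j)"])
    finally show ?thesis by linarith
  qed
  then have "finite (range W)" by (auto intro: finite_subset[OF _ finite_bounded_int_matrices[of "\<lceil>K\<rceil>"]])
  then have "\<not> inj W" using finite_imageD infinite_UNIV_nat by blast
  then obtain i j where ij: "i < j" "W i = W j" by (metis injI linorder_neqE_nat)
  have "W (i + k) = W i ** W k" for k
    by (induction i) (simp_all add: W_def r)
  then have "W j = W i ** W (j - i)" using ij by (metis le_add_diff_inverse less_imp_le)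
  moreover have "W k \<in> GLZ" for k
  proof (induction k)
    case 0
    show ?case by (auto simp: W_def GLZ_def invertible_def intro!: exI[of _ "mat 1"])
  next
    case (Suc k)
    have "contragredient F \<in> GLZ"
      using contragredient_inverse[OF F] by (auto simp: GLZ_def invertible_def)
    then have "M \<in> GLZ" using F by (simp add: M_def GLZ_mult)
    then show ?case using Suc by (simp add: W_def GLZ_mult)
  qed
  ultimately have "W (j - i) = mat 1"
    using ij(2) by (metis GLZ_inverse matrix_mul_assoc matrix_mul_lid)
  then show ?thesis unfolding has_finite_order_def M_def[symmetric] W_def using ij(1) by (intro exI[of _ "j - i"]) auto
qed


subsection \<open>Isodual types\<close>

text \<open>The sums on the right form a submodule containing the generators. Coefficients are
  indexed by \<open>I\<close> rather than by vectors, as needed for expansions in rows.\<close>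

lemma int_span_image_finite:
  assumes "finite I" "x \<in> int_span (f ` I)"
  shows "\<exists>c. x = (\<Sum>i\<in>I. of_int (c i) *\<^sub>R f i)"
proof -
  let ?V = "{\<Sum>i\<in>I. of_int (c i) *\<^sub>R f i | c. True}"
  have "int_span (f ` I) \<subseteq> ?V"
  proof (rule int_module.span_minimal)
    show "f ` I \<subseteq> ?V"
    proof
      fix y assume "y \<in> f ` I"
      then obtain i where i: "i \<in> I" "y = f i" by auto
      have "y = (\<Sum>j\<in>I. of_int (if j = i then 1 else 0) *\<^sub>R f j)"
        using i assms(1) by (simp add: if_distrib[of "\<lambda>c. of_int c *\<^sub>R _"] cong: if_cong)
      then show "y \<in> ?V" by (intro CollectI exI[of _ "\<lambda>j. if j = i then 1 else 0"]) simp
    qed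
    show "int_module.subspace ?V"
      unfolding int_module.subspace_def
    proof (intro conjI ballI allI)
      show "0 \<in> ?V" by (auto intro!: exI[of _ "\<lambda>_. 0"])
    next
      fix y z assume "y \<in> ?V" "z \<in> ?V"
      then obtain c d where "y = (\<Sum>i\<in>I. of_int (c i) *\<^sub>R f i)" "z = (\<Sum>i\<in>I. of_int (d i) *\<^sub>R f i)" by auto
      then have "y + z = (\<Sum>i\<in>I. of_int (c i + d i) *\<^sub>R f i)"
        by (simp add: scaleR_add_left sum.distrib)
      then show "y + z \<in> ?V" by (intro CollectI exI[of _ "\<lambda>i. c i + d i"]) simp
    next
      fix k y assume "y \<in> ?V"
      then obtain c where "y = (\<Sum>i\<in>I. of_int (c i) *\<^sub>R f i)" by auto
      then have "of_int k *\<^sub>R y = (\<Sum>i\<in>I. of_int (k * c i) *\<^sub>R f i)"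
        by (simp add: scaleR_sum_right)
      then show "of_int k *\<^sub>R y \<in> ?V" by (intro CollectI exI[of _ "\<lambda>i. k * c i"]) simp
    qed
  qed
  then show ?thesis using assms(2) by auto
qed

text \<open>Links independence of a set to that of an indexed family; injectivity excludes repeated
  vectors.\<close>

lemma inj_independent_range_iff:
  fixes b :: "'n::finite \<Rightarrow> 'a::real_vector"
  shows "inj b \<and> independent (range b) \<longleftrightarrow> (\<forall>c. (\<Sum>i\<in>UNIV. c i *\<^sub>R b i) = 0 \<longrightarrow> (\<forall>i. c i = 0))"
proof (intro iffI conjI allI impI)
  fix c i assume b: "inj b \<and> independent (range b)" and c: "(\<Sum>i\<in>UNIV. c i *\<^sub>R b i) = 0"
  have "(\<Sum>v\<in>range b. c (inv b v) *\<^sub>R v) = 0" using b c by (simp add: sum.reindex)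
  then have "c (inv b (b i)) = 0" using b by (intro independentD[of "range b" "range b"]) auto
  then show "c i = 0" using b by simp
next
  assume b: "\<forall>c. (\<Sum>i\<in>UNIV. c i *\<^sub>R b i) = 0 \<longrightarrow> (\<forall>i. c i = 0)"
  show inj: "inj b"
  proof (rule injI, rule ccontr)
    fix i j assume ij: "b i = b j" "i \<noteq> j"
    let ?c = "\<lambda>k. (if k = i then 1 else 0) - (if k = j then 1 else 0 :: real)"
    have "(\<Sum>k\<in>UNIV. ?c k *\<^sub>R b k) = b i - b j"
      by (simp add: scaleR_diff_left sum_subtractf if_distrib[of "\<lambda>c. c *\<^sub>R _"] cong: if_cong)
    then have "\<forall>k. ?c k = 0" using b[THEN spec, of ?c] ij(1) by simp
    then have "?c i = 0" by (rule spec)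
    then show False using ij(2) by simp
  qed
  show "independent (range b)"
  proof
    assume "dependent (range b)"
    then obtain u v where u: "v \<in> range b" "u v \<noteq> 0" "(\<Sum>v\<in>range b. u v *\<^sub>R v) = 0"
      by (auto simp: dependent_finite)
    then have "(\<Sum>i\<in>UNIV. u (b i) *\<^sub>R b i) = 0" using inj by (simp add: sum.reindex)
    then have "\<forall>i. u (b i) = 0" using b[THEN spec, of "\<lambda>i. u (b i)"] by simp
    then show False using u by auto
  qed
qed

lemma invertible_iff_rows_independent:
  fixes B :: "real^'n^'n"
  shows "invertible B \<longleftrightarrow> inj (\<lambda>i. row i B) \<and> independent (range (\<lambda>i. row i B))"
  unfolding inj_independent_range_iff invertible_right_inverse matrix_right_invertible_independent_rows
  by (simp add: scalar_mult_eq_scaleR)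

definition real_vec :: "int^'n \<Rightarrow> real^'n" where
  "real_vec c = (\<chi> i. of_int (c $ i))"

lemma real_vec_matrix_mult: "real_vec (F *v c) = real_matrix F *v real_vec c"
  by (simp add: real_vec_def real_matrix_def matrix_vector_mult_def vec_eq_iff)

lemma sum_rows_eq:
  fixes B :: "real^'n^'n"
  shows "(\<Sum>i\<in>UNIV. of_int (c i) *\<^sub>R row i B) = transpose B *v real_vec (\<chi> i. c i)"
  by (simp add: vec_eq_iff real_vec_def row_def matrix_vector_mult_def transpose_def mult.commute)

lemma lattice_basis_rows_iff:
  "lattice_basis (\<lambda>i. row i B) L \<longleftrightarrow> invertible B \<and> L = range (\<lambda>c. transpose B *v real_vec c)"
proof -
  have "{(\<Sum>i\<in>UNIV. of_int (c i) *\<^sub>R row i B) | c. True} = range (\<lambda>c. transpose B *v real_vec c)"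
    unfolding sum_rows_eq by (auto, metis vec_nth_inverse)
  then show ?thesis unfolding lattice_basis_def invertible_iff_rows_independent by auto
qed

text \<open>The standard integral lattice is its own dual, as testing against the unit vectors
  shows.\<close>

lemma real_vec_iff: "(\<forall>c. real_vec c \<bullet> y \<in> \<int>) \<longleftrightarrow> y \<in> range real_vec"
proof
  assume y: "\<forall>c. real_vec c \<bullet> y \<in> \<int>"
  have "y $ i \<in> \<int>" for i
  proof -
    have "real_vec (axis i 1) = axis i 1" by (simp add: real_vec_def axis_def vec_eq_iff)
    then show ?thesis using y by (metis inner_axis' inner_real_def mult_1)
  qed
  then have "y = real_vec (\<chi> i. \<lfloor>y $ i\<rfloor>)" by (simp add: vec_eq_iff real_vec_def)
  then show "y \<in> range real_vec" by blast
qed (auto simp: real_vec_def inner_vec_def)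

text \<open>The rows of \<open>B\<close> are a lattice basis and \<open>S\<close> is the matrix of
  the isometry. For the converse take the lattice L spanned by the rows: y is in its dual exactly if
  B y is integral, and B S maps L onto the image of the integral vectors under F, which is all of
  them since F is unimodular.\<close>

lemma represents_isodual_type_iff:
  fixes F :: "int^'n^'n"
  assumes F: "F \<in> GLZ"
  shows "represents_isodual_type F \<longleftrightarrow>
    (\<exists>B S :: real^'n^'n. invertible B \<and> orthogonal_matrix S \<and> real_matrix F = B ** S ** transpose B)"
proof
  assume "represents_isodual_type F"
  then obtain L \<sigma> b where \<sigma>: "orthogonal_transformation \<sigma>" and b: "lattice_basis b L"
    and Fb: "\<And>i j. of_int (F $ i $ j) = b i \<bullet> \<sigma> (b j)"
    unfolding represents_isodual_type_def isodual_lattice_def represents_type_of_def by blast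
  define B where "B = (\<chi> i. b i)"
  have rB: "row i B = b i" for i by (simp add: B_def row_def)
  have "invertible B" using b lattice_basis_rows_iff[of B L] by (simp add: rB)
  moreover have "orthogonal_matrix (matrix \<sigma>)" "\<And>x. matrix \<sigma> *v x = \<sigma> x"
    using \<sigma> by (auto simp: orthogonal_transformation_matrix matrix_works)
  moreover from this have "real_matrix F = B ** matrix \<sigma> ** transpose B"
    by (simp add: vec_eq_iff[of "real_matrix F"] vec_eq_iff[of "_ $ _" "_ $ _"] row_matrix_congruence real_matrix_nth rB Fb)
  ultimately show "\<exists>B S :: real^'n^'n. invertible B \<and> orthogonal_matrix S \<and> real_matrix F = B ** S ** transpose B"
    by blast
next
  assume "\<exists>B S :: real^'n^'n. invertible B \<and> orthogonal_matrix S \<and> real_matrix F = B ** S ** transpose B"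
  then obtain B S :: "real^'n^'n" where B: "invertible B" and S: "orthogonal_matrix S"
    and FB: "real_matrix F = B ** S ** transpose B" by blast
  define L where "L = range (\<lambda>c. transpose B *v real_vec c)"
  have basis: "lattice_basis (\<lambda>i. row i B) L" using B by (simp add: lattice_basis_rows_iff L_def)
  have dual: "y \<in> dual_lattice L \<longleftrightarrow> B *v y \<in> range real_vec" for y
  proof -
    have "(transpose B *v real_vec c) \<bullet> y = real_vec c \<bullet> (B *v y)" for c
      by (metis dot_lmul_matrix transpose_matrix_vector)
    then show ?thesis by (simp add: dual_lattice_def L_def flip: real_vec_iff)
  qed
  have BS: "B *v (S *v (transpose B *v real_vec c)) = real_vec (F *v c)" for c
    by (simp only: real_vec_matrix_mult FB matrix_vector_mul_assoc matrix_mul_assoc)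
  have "(*v) S ` L = dual_lattice L"
  proof
    show "(*v) S ` L \<subseteq> dual_lattice L"
    proof
      fix y assume "y \<in> (*v) S ` L"
      then obtain c where "y = S *v (transpose B *v real_vec c)" unfolding L_def by blast
      then have "B *v y = real_vec (F *v c)" by (simp only: BS)
      then show "y \<in> dual_lattice L" by (simp add: dual)
    qed
    show "dual_lattice L \<subseteq> (*v) S ` L"
    proof
      fix y assume "y \<in> dual_lattice L"
      then obtain z where z: "B *v y = real_vec z" using dual by auto
      \<comment> \<open>The integral inverse of \<open>F\<close> supplies the preimage in the
        lattice.\<close>
      obtain U where U: "F ** U = mat 1" using GLZ_inverse[OF F] by metis
      have "B *v (S *v (transpose B *v real_vec (U *v z))) = B *v y"
        unfolding BS z by (simp add: matrix_vector_mul_assoc U)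
      then have "S *v (transpose B *v real_vec (U *v z)) = y"
        using inj_matrix_vector_mult[OF B] by (simp add: inj_eq)
      then show "y \<in> (*v) S ` L" unfolding L_def by blast
    qed
  qed
  moreover have "lattice L" using basis by (auto simp: lattice_def)
  ultimately have "isodual_lattice L ((*v) S)"
    using orthogonal_transformation_matrix_vector_mult[OF S] by (simp add: isodual_lattice_def)
  moreover have "represents_type_of F L ((*v) S)"
    unfolding represents_type_of_def using F basis
    by (auto intro!: exI[of _ "\<lambda>i. row i B"] simp: FB row_matrix_congruence simp flip: real_matrix_nth)
  ultimately show "represents_isodual_type F" unfolding represents_isodual_type_def by blast
qed

section \<open>Bounded representatives of integral classes\<close>

lemma matrix_eq_if_rows_sum:
  fixes A B :: "real^'n^'n"
  assumes "\<And>i. row i A = (\<Sum>j\<in>UNIV. of_int (T i j) *\<^sub>R row j B)"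
  shows "A = real_matrix (\<chi> i j. T i j) ** B"
proof -
  have "A $ i $ j = (\<Sum>k\<in>UNIV. of_int (T i k) * B $ k $ j)" for i j
    using arg_cong[OF assms[of i], of "\<lambda>v. v $ j"] by (simp add: row_def)
  then show ?thesis by (simp add: vec_eq_iff real_matrix_def matrix_matrix_mult_def)
qed

text \<open>Passing to a reduced basis of the same lattice replaces \<open>F\<close> by an
  integrally congruent matrix, whose entries \<open>inner_basis_le\<close> bounds in terms of the
  rank alone.\<close>

lemma ex_bounded_congruent:
  fixes F :: "int^'n^'n"
  assumes F: "F \<in> GLZ" and rep: "represents_isodual_type F"
  defines "n \<equiv> CARD('n)"
  shows "\<exists>T\<in>GLZ. \<forall>i j. \<bar>(T ** F ** transpose T) $ i $ j\<bar> \<le> \<lceil>real n * (real n * (2 ^ n * (1 + real n * 2 ^ n) ^ n)\<^sup>2)\<rceil>"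
proof -
  note r = matrix_mul_assoc[symmetric]
  obtain B S :: "real^'n^'n" where B: "invertible B" and S: "orthogonal_matrix S"
    and FB: "real_matrix F = B ** S ** transpose B"
    using rep represents_isodual_type_iff[OF F] by blast
  let ?R = "range (\<lambda>i. row i B)"
  have R: "inj (\<lambda>i. row i B)" "independent ?R" using B invertible_iff_rows_independent by auto
  then have "card ?R = n" by (simp add: card_image n_def)
  then obtain b g N where red: "gs_reduced n b g N" and bR: "int_span (b ` {..<n}) = int_span ?R"
    using ex_gs_reduced[OF R(2)] by blast
  \<comment> \<open>\<open>h\<close> translates between the index type of the matrices and the
    natural indices of the reduced basis.\<close>
  obtain h where h: "bij_betw h (UNIV :: 'n set) {..<n}"
    using ex_bij_betw_finite_nat[of "UNIV :: 'n set"] by (auto simp: n_def atLeast0LessThan)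
  then have hn: "h i < n" for i by (auto simp: bij_betw_def)
  have hinv: "\<exists>i. k = h i" if "k < n" for k
    using h that unfolding bij_betw_def by (metis imageE lessThan_iff)
  define B' where "B' = (\<chi> i. b (h i))"
  have rB': "row i B' = b (h i)" for i by (simp add: B'_def row_def)
  have "\<exists>c. row i B' = (\<Sum>j\<in>UNIV. of_int (c j) *\<^sub>R row j B)" for i
  proof (rule int_span_image_finite)
    have "b (h i) \<in> int_span (b ` {..<n})" using hn by (intro int_module.span_base) auto
    then show "row i B' \<in> int_span ?R" by (simp add: rB' bR)
  qed simp
  then obtain T where "\<And>i. row i B' = (\<Sum>j\<in>UNIV. of_int (T i j) *\<^sub>R row j B)" by metis
  then have T: "B' = real_matrix (\<chi> i j. T i j) ** B" by (rule matrix_eq_if_rows_sum)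
  have "\<exists>c. row i B = (\<Sum>j\<in>UNIV. of_int (c j) *\<^sub>R row j B')" for i
  proof -
    have "row i B \<in> int_span (b ` {..<n})" unfolding bR by (intro int_module.span_base) auto
    moreover have "b ` {..<n} = range (\<lambda>j. row j B')"
      using h by (simp add: rB' bij_betw_def image_image[of b h, symmetric])
    ultimately show ?thesis using int_span_image_finite[of "UNIV :: 'n set"] by simp
  qed
  then obtain U where "\<And>i. row i B = (\<Sum>j\<in>UNIV. of_int (U i j) *\<^sub>R row j B')" by metis
  then have U: "B = real_matrix (\<chi> i j. U i j) ** B'" by (rule matrix_eq_if_rows_sum)
  define T' where "T' = (\<chi> i j. T i j)"
  define U' where "U' = (\<chi> i j. U i j)"
  obtain Bi where Bi: "B ** Bi = mat 1" "Bi ** B = mat 1" using B by (auto simp: invertible_def)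
  \<comment> \<open>Expanding each basis in the other and cancelling \<open>B\<close> shows that the
    integral transition matrices are inverse to each other.\<close>
  have "real_matrix (U' ** T') ** B = B"
    using T U by (simp add: real_matrix_mult T'_def U'_def r)
  then have "real_matrix (U' ** T') ** B ** Bi = B ** Bi" by simp
  then have UT: "real_matrix U' ** real_matrix T' = mat 1" by (simp add: r Bi real_matrix_mult)
  then have TU: "real_matrix T' ** real_matrix U' = mat 1" by (rule matrix_left_right_inverse[THEN iffD1])
  have T'G: "T' \<in> GLZ"
    unfolding GLZ_def invertible_def
    using UT TU by (auto simp: real_matrix_inject simp flip: real_matrix_mult real_matrix_one)
  define F' where "F' = T' ** F ** transpose T'"
  have F'G: "F' \<in> GLZ" unfolding F'_def using F T'G by (intro GLZ_mult GLZ_transpose)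
  have F'B: "real_matrix F' = B' ** S ** transpose B'"
    by (simp add: F'_def T T'_def[symmetric] FB real_matrix_mult real_matrix_transpose matrix_transpose_mul r)
  have "invertible B'" unfolding T T'_def[symmetric]
    by (intro invertible_mult B invertible_real_matrix T'G)
  then obtain D where D: "B' ** D = mat 1" "D ** B' = mat 1" by (auto simp: invertible_def)
  \<comment> \<open>The columns of the inverse of \<open>B'\<close> form the basis dual to the rows
    of \<open>B'\<close>.\<close>
  define c where "c k = row (inv h k) (transpose D)" for k
  have injh: "inj h" using h by (simp add: bij_betw_def)
  then have ch: "c (h i) = row i (transpose D)" for i by (simp add: c_def)
  have span_b: "span (b ` {..<n}) = UNIV"
  proof -
    have "rows B = ?R" by (auto simp: rows_def)
    then have "span ?R = UNIV" using B matrix_left_invertible_span_rows[of B] by (simp add: invertible_left_inverse)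
    then show ?thesis using bR span_int_span by metis
  qed
  have dual: "c i \<bullet> b j = (if i = j then 1 else 0)" if ij: "i < n" "j < n" for i j
  proof -
    obtain i' j' where i': "i = h i'" "j = h j'" using hinv ij by metis
    have "c i \<bullet> b j = (B' ** transpose (transpose D)) $ j' $ i'"
      unfolding row_matrix_mult_transpose by (simp add: i' ch rB' inner_commute)
    also have "\<dots> = (if i = j then 1 else 0)" using D injh by (auto simp: mat_def i' inj_eq)
    finally show ?thesis .
  qed
  interpret gs_reduced_dual n b g c N using red span_b dual by unfold_locales
  \<comment> \<open>In the dual basis the form has the contragredient as its matrix. This gives the
    integrality of \<open>c i \<bullet> (S *v c j)\<close> that the bounds require.\<close>
  have tD: "transpose D ** S ** D = real_matrix (contragredient F')"
  proof -
    have "transpose (B' ** S ** transpose B') ** (transpose D ** S ** D)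
        = B' ** (transpose S ** (transpose (D ** B') ** S)) ** D"
      by (simp add: matrix_transpose_mul r)
    also have "\<dots> = mat 1" using D S by (simp add: orthogonal_matrix_def)
    finally have 1: "transpose (real_matrix F') ** (transpose D ** S ** D) = mat 1" by (simp add: F'B)
    have "real_matrix (contragredient F') ** transpose (real_matrix F') = mat 1"
      using contragredient_inverse(2)[OF F'G] by (metis real_matrix_mult real_matrix_one real_matrix_transpose)
    then show ?thesis using 1 by (metis matrix_mul_assoc matrix_mul_lid matrix_mul_rid)
  qed
  have int: "c i \<bullet> (S *v c j) \<in> \<int>" if ij: "i < n" "j < n" for i j
  proof -
    obtain i' j' where i': "i = h i'" "j = h j'" using hinv ij by metis
    have "c i \<bullet> (S *v c j) = (transpose D ** S ** transpose (transpose D)) $ i' $ j'"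
      unfolding row_matrix_congruence by (simp add: i' ch)
    also have "\<dots> = of_int (contragredient F' $ i' $ j')" by (simp add: tD real_matrix_nth)
    finally show ?thesis by simp
  qed
  have "\<bar>F' $ i $ j\<bar> \<le> \<lceil>real n * (real n * (2 ^ n * (1 + real n * 2 ^ n) ^ n)\<^sup>2)\<rceil>" for i j
  proof -
    have "of_int (F' $ i $ j) = b (h i) \<bullet> (S *v b (h j))"
      unfolding real_matrix_nth[symmetric] F'B row_matrix_congruence rB' ..
    moreover have "\<bar>b (h i) \<bullet> (S *v b (h j))\<bar> \<le> real n * (real n * (2 ^ n * (1 + real n * 2 ^ n) ^ n)\<^sup>2)"
      by (rule inner_basis_le[OF orthogonal_transformation_matrix_vector_mult[OF S] int hn hn])
    ultimately show ?thesis by linarith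
  qed
  then show ?thesis using T'G unfolding F'_def by blast
qed

section \<open>Invariance under integral congruence\<close>

lemma integral_class_congruence:
  assumes T: "T \<in> GLZ" shows "integral_class (T ** F ** transpose T) = integral_class F"
proof -
  note r = matrix_mul_assoc[symmetric]
  obtain U where U: "U \<in> GLZ" "T ** U = mat 1" "U ** T = mat 1" using GLZ_inverse[OF T] .
  have "\<exists>Y\<in>GLZ. X ** (T ** F ** transpose T) ** transpose X = Y ** F ** transpose Y" if "X \<in> GLZ" for X
    using that T by (intro bexI[of _ "X ** T"] GLZ_mult) (simp_all add: matrix_transpose_mul r)
  moreover have "\<exists>Y\<in>GLZ. X ** F ** transpose X = Y ** (T ** F ** transpose T) ** transpose Y" if "X \<in> GLZ" for X
  proof (intro bexI[of _ "X ** U"] GLZ_mult that U)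
    have "(X ** U) ** (T ** F ** transpose T) ** transpose (X ** U)
       = X ** (U ** T) ** F ** transpose (U ** T) ** transpose X"
      by (simp add: matrix_transpose_mul r)
    then show "X ** F ** transpose X = (X ** U) ** (T ** F ** transpose T) ** transpose (X ** U)"
      by (simp add: U)
  qed
  ultimately show ?thesis unfolding integral_class_def by fast
qed

lemma GLZ_act_mult: "GLZ_act (A ** B) X = GLZ_act A (GLZ_act B X)"
  by (simp add: GLZ_act_def real_matrix_mult matrix_transpose_mul matrix_mul_assoc)

lemma GLZ_act_one: "GLZ_act (mat 1) X = X"
  by (simp add: GLZ_act_def real_matrix_one)

lemma GLZ_act_P_space:
  assumes T: "T \<in> GLZ" and A: "A \<in> P_space" shows "GLZ_act T A \<in> P_space"
  unfolding P_space_def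
proof (intro CollectI conjI allI impI)
  show "transpose (GLZ_act T A) = GLZ_act T A"
    using A by (simp add: P_space_def GLZ_act_def matrix_transpose_mul matrix_mul_assoc)
  fix x :: "real^'a" assume x: "x \<noteq> 0"
  have "inj ((*v) (transpose (real_matrix T)))"
    by (rule inj_matrix_vector_mult) (rule transpose_invertible[OF invertible_real_matrix[OF T]])
  then have "transpose (real_matrix T) *v x \<noteq> 0" using x by (metis injD matrix_vector_mult_0_right)
  then have "0 < (transpose (real_matrix T) *v x) \<bullet> (A *v (transpose (real_matrix T) *v x))"
    using A by (simp add: P_space_def)
  also have "\<dots> = x \<bullet> (GLZ_act T A *v x)"
    by (simp add: GLZ_act_def transpose_matrix_vector dot_lmul_matrix flip: matrix_vector_mul_assoc)
  finally show "0 < x \<bullet> (GLZ_act T A *v x)" .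
next
  obtain U where U: "T ** U = mat 1" using GLZ_inverse[OF T] by metis
  have "det T * det U = 1" using arg_cong[OF U, of det] by (simp add: det_mul)
  \<comment> \<open>The determinant of \<open>T\<close> is an integer unit, 1 or -1, and enters the
    action through its square.\<close>
  then have "det T * det T = 1" by (auto simp: zmult_eq_1_iff)
  then have "(of_int (det T) :: real) * of_int (det T) = 1" by (metis of_int_1 of_int_mult)
  then show "det (GLZ_act T A) = 1"
    using A by (simp add: GLZ_act_def det_mul det_real_matrix P_space_def)
qed

text \<open>In (T A T') (U' (contragredient F) U) (T A T') the inner factors T' U' and U T cancel,
  leaving T F T'.\<close>

lemma GLZ_act_V_set_subset:
  assumes F: "F \<in> GLZ" and T: "T \<in> GLZ"
  shows "GLZ_act T ` V_set F \<subseteq> V_set (T ** F ** transpose T)"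
proof
  fix X assume "X \<in> GLZ_act T ` V_set F"
  then obtain A where A: "X = GLZ_act T A" "A \<in> P_space" "A ** real_matrix (contragredient F) ** A = real_matrix F"
    by (auto simp: V_set_def)
  obtain U where U: "U \<in> GLZ" "T ** U = mat 1" "U ** T = mat 1" using GLZ_inverse[OF T] .
  have rU: "real_matrix U ** real_matrix T = mat 1" using U(3) by (metis real_matrix_mult real_matrix_one)
  have tU: "transpose (real_matrix T) ** transpose (real_matrix U) = mat 1"
    using rU by (metis matrix_transpose_mul transpose_mat)
  have "X ** real_matrix (contragredient (T ** F ** transpose T)) ** X
      = real_matrix T ** A ** (transpose (real_matrix T) ** transpose (real_matrix U)) ** real_matrix (contragredient F)
        ** (real_matrix U ** real_matrix T) ** A ** transpose (real_matrix T)"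
    by (simp add: contragredient_congruence[OF F T U(2,3)] A(1) GLZ_act_def real_matrix_mult
        real_matrix_transpose matrix_mul_assoc)
  also have "\<dots> = real_matrix T ** (A ** real_matrix (contragredient F) ** A) ** transpose (real_matrix T)"
    by (simp only: rU tU matrix_mul_rid matrix_mul_assoc)
  also have "\<dots> = real_matrix (T ** F ** transpose T)"
    by (simp add: A(3) real_matrix_mult real_matrix_transpose)
  finally show "X \<in> V_set (T ** F ** transpose T)"
    using GLZ_act_P_space[OF T A(2)] by (simp add: V_set_def A(1))
qed

text \<open>The reverse inclusion is the previous lemma applied to T F T' and the inverse of
  \<open>T\<close>.\<close>

lemma V_set_congruence:
  assumes F: "F \<in> GLZ" and T: "T \<in> GLZ"
  shows "V_set (T ** F ** transpose T) = GLZ_act T ` V_set F"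
proof
  obtain U where U: "U \<in> GLZ" "T ** U = mat 1" "U ** T = mat 1" using GLZ_inverse[OF T] .
  let ?G = "T ** F ** transpose T"
  have "U ** ?G ** transpose U = (U ** T) ** F ** transpose (U ** T)"
    by (simp add: matrix_transpose_mul matrix_mul_assoc)
  then have G: "U ** ?G ** transpose U = F" by (simp add: U)
  have "?G \<in> GLZ" using F T by (intro GLZ_mult GLZ_transpose)
  then have "GLZ_act U ` V_set ?G \<subseteq> V_set F" using GLZ_act_V_set_subset[OF _ U(1), of ?G] G by simp
  then have "GLZ_act T ` GLZ_act U ` V_set ?G \<subseteq> GLZ_act T ` V_set F" by (rule image_mono)
  then show "V_set ?G \<subseteq> GLZ_act T ` V_set F"
    by (simp add: image_image U GLZ_act_one flip: GLZ_act_mult)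
qed (rule GLZ_act_V_set_subset[OF F T])

lemma subset_orbit_GLZ_act:
  assumes T: "T \<in> GLZ" shows "subset_orbit (GLZ_act T ` V) = subset_orbit V"
proof -
  obtain U where U: "U \<in> GLZ" "T ** U = mat 1" "U ** T = mat 1" using GLZ_inverse[OF T] .
  have "\<exists>Y\<in>GLZ. GLZ_act X ` GLZ_act T ` V = GLZ_act Y ` V" if "X \<in> GLZ" for X
    using that T by (intro bexI[of _ "X ** T"] GLZ_mult) (simp_all add: image_image GLZ_act_mult)
  moreover have "\<exists>Y\<in>GLZ. GLZ_act X ` V = GLZ_act Y ` GLZ_act T ` V" if "X \<in> GLZ" for X
  proof (intro bexI[of _ "X ** U"] GLZ_mult that U)
    have "GLZ_act (X ** U) (GLZ_act T v) = GLZ_act X v" for v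
      by (simp add: U flip: GLZ_act_mult matrix_mul_assoc)
    then show "GLZ_act X ` V = GLZ_act (X ** U) ` GLZ_act T ` V" by (simp add: image_image)
  qed
  ultimately have "(\<exists>X\<in>GLZ. W = GLZ_act X ` GLZ_act T ` V) \<longleftrightarrow> (\<exists>X\<in>GLZ. W = GLZ_act X ` V)" for W
    by metis
  then show ?thesis unfolding subset_orbit_def by (simp only: Bex_def conj_commute cong: conj_cong)
qed

section \<open>Finiteness of the sets of types\<close>

lemma represents_imp_GLZ: "represents_isodual_type F \<Longrightarrow> F \<in> GLZ"
  by (auto simp: represents_isodual_type_def represents_type_of_def)

text \<open>Serves both finiteness claims: an invariant of integral congruence takes all its values
  on isodual types already at the finitely many matrices with bounded entries.\<close>

lemma finite_image_isodual_types:
  fixes f :: "int^'n^'n \<Rightarrow> 'b"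
  assumes "\<And>F T. F \<in> GLZ \<Longrightarrow> T \<in> GLZ \<Longrightarrow> f (T ** F ** transpose T) = f F"
  shows "finite {f F | F. represents_isodual_type F}"
proof -
  obtain K where K: "\<And>F :: int^'n^'n. F \<in> GLZ \<Longrightarrow> represents_isodual_type F \<Longrightarrow>
      \<exists>T\<in>GLZ. \<forall>i j. \<bar>(T ** F ** transpose T) $ i $ j\<bar> \<le> K"
    using ex_bounded_congruent by blast
  have "f F \<in> f ` {F. \<forall>i j. \<bar>F $ i $ j\<bar> \<le> K}" if rep: "represents_isodual_type F" for F
  proof -
    have F: "F \<in> GLZ" using rep by (rule represents_imp_GLZ)
    then obtain T where "T \<in> GLZ" "\<forall>i j. \<bar>(T ** F ** transpose T) $ i $ j\<bar> \<le> K"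
      using K[OF F rep] by blast
    then show ?thesis using assms[OF F] by (intro image_eqI[of _ _ "T ** F ** transpose T"]) simp_all
  qed
  then have "{f F | F. represents_isodual_type F} \<subseteq> f ` {F. \<forall>i j. \<bar>F $ i $ j\<bar> \<le> K}" by blast
  then show ?thesis using finite_bounded_int_matrices finite_imageI finite_subset by blast
qed

theorem theorem1p1:
  shows "(\<forall>F :: int^'n^'n \<in> GLZ.
            represents_isodual_type F \<longleftrightarrow> has_finite_order (F ** contragredient F))
       \<and> finite (isodual_algebraic_types :: (int^'n^'n) set set)
       \<and> finite (isodual_geometric_types :: (real^'n^'n) set set set)"
proof (intro conjI ballI)
  fix F :: "int^'n^'n" assume F: "F \<in> GLZ"
  show "represents_isodual_type F \<longleftrightarrow> has_finite_order (F ** contragredient F)"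
    unfolding represents_isodual_type_iff[OF F]
    using orthogonal_congruence_imp_has_finite_order[OF F]
      has_finite_order_imp_orthogonal_congruence[OF F] by metis
next
  show "finite (isodual_algebraic_types :: (int^'n^'n) set set)"
    unfolding isodual_algebraic_types_def
    by (rule finite_image_isodual_types) (rule integral_class_congruence)
next
  show "finite (isodual_geometric_types :: (real^'n^'n) set set set)"
    unfolding isodual_geometric_types_def
    by (rule finite_image_isodual_types) (simp add: V_set_congruence subset_orbit_GLZ_act)
qed

end
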